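(* Let $E$ be a uniformly smooth and uniformly convex real Banach space with dual space $E^*$ and normalized duality map $J$, and let $C$ be a nonempty closed and convex subset of $E$ such that $JC$ is closed and convex. Let $f_l : JC\times JC\to\mathbb{R}$, $l=1,\dots,L$, be a family of bifunctions satisfying (A1)–(A4); let $T_n : C\to E^*$, $n=1,2,3,\dots$, be an infinite family of generalized $J_*$-nonexpansive maps; let $A_k : C\to E^*$, $k=1,\dots,N$, be a finite family of continuous monotone mappings; and let $\Gamma$ be a family of $J_*$-closed and generalized $J_*$-nonexpansive maps from $C$ to $E^*$ such that $\bigcap_{n=1}^{\infty}F_J(T_n)=F_J(\Gamma)\neq\emptyset$ and $$B:=F_J(\Gamma)\cap\Big[\bigcap_{l=1}^{L}EP(f_l)\Big]\cap\Big[\bigcap_{k=1}^{N}VI(C,A_k)\Big]\neq\emptyset .$$ Assume that $JF_J(\Gamma)$ is convex and that $\{T_n\}$ satisfies the NST-condition with $\Gamma$. Let $\alpha_1,\alpha_2,\alpha_3\in(0,1)$ with $\alpha_1+\alpha_2+\alpha_3=1$, let $\{r_n\}\subset[a,\infty)$ for some $a>0$, let $x\in C$, and let $\{x_n\}$ be generated by $x_1=x$, $C_1=C$ and, for all $n\in\mathbb{N}$, $$\begin{cases} z_n\in C:\ f_n(Jz_n,Jy)+\frac1{r_n}\langle y-z_n,Jz_n-Jx_n\rangle\ge 0\ \ \forall y\in C,\\ u_n\in C:\ \langle y-u_n,A_nu_n\rangle+\frac1{r_n}\langle y-u_n,Ju_n-Jx_n\rangle\ge 0\ \ \forall y\in C,\\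 y_n=J^{-1}(\alpha_1Jx_n+\alpha_2Jz_n+\alpha_3T_nu_n),\\ C_{n+1}=\{z\in C_n:\phi(z,y_n)\le\phi(z,x_n)\},\\ x_{n+1}=R_{C_{n+1}}x,\end{cases}$$ where $A_n=A_{n(\mathrm{mod}\,N)}$, $f_n=f_{n(\mathrm{mod}\,L)}$, and $R_{C_{n+1}}$ is the sunny generalized nonexpansive retraction of $E$ onto $C_{n+1}$. Then $\{x_n\}$ converges strongly to $R_Bx$, where $R_B$ is the sunny generalized nonexpansive retraction of $E$ onto $B$.
   Context: $\langle\cdot,\cdot\rangle$ is the duality pairing between $E$ and $E^*$. The normalized duality map is $Jx=\{x^*\in E^*:\langle x,x^*\rangle=\|x\|\,\|x^*\|,\ \|x\|=\|x^*\|\}$; in the present setting it is a single-valued bijection $E\to E^*$ and $J_*=J^{-1}$ is the normalized duality map of $E^*$. The Lyapunov functional is $\phi(x,y)=\|x\|^2-2\langle x,Jy\rangle+\|y\|^2$ for $x,y\in E$. Conditions on a bifunction $f:JC\times JC\to\mathbb{R}$: (A1) $f(x^*,x^* )=0$ for all $x^*\in JC$; (A2) $f(x^*,y^* )+f(y^*,x^* )\le0$ for all $x^*,y^*\in JC$; (A3) $\limsup_{t\downarrow0}f(tz^*+(1-t)x^*,y^* )\le f(x^*,y^* )$ for all $x^*,y^*,z^*\in JC$; (A4) $f(x^*,\cdot)$ is convex and lower semicontinuous for every $x^*\in JC$. $EP(f)=\{x^*\in C: f(Jx^*,Jy)\ge0\ \forall y\in C\}$. For $A:C\to E^*$, $VI(C,A)=\{x^*\in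 C:\langle y-x^*,Ax^*\rangle\ge0\ \forall y\in C\}$; $A$ is monotone if $\langle u-v,Au-Av\rangle\ge0$ for all $u,v\in C$. For $T:C\to E^*$: $F_J(T)=\{x\in C:Tx=Jx\}$ is the set of $J$-fixed points. $T$ is generalized $J_*$-nonexpansive if $F_J(T)\ne\emptyset$ and $\phi(p,(J_*\circ T)x)\le\phi(p,x)$ for all $x\in C$, $p\in F_J(T)$. $T$ is $J_*$-closed if whenever $\{x_n\}\subset C$, $x_n\to x$ and $(J_*\circ T)x_n\to y$, then $(J_*\circ T)x=y$. For a family $\Gamma$ of such maps, $F_J(\Gamma)=\bigcap_{T\in\Gamma}F_J(T)$. $\{T_n\}$ satisfies the NST-condition with $\Gamma$ if for each bounded sequence $\{x_n\}\subset C$, $\lim_{n}\|Jx_n-T_nx_n\|=0$ implies $\lim_n\|Jx_n-Tx_n\|=0$ for all $T\in\Gamma$. A retraction $R$ of $E$ onto a nonempty closed set $D\subset E$ (i.e. $R$ maps $E$ onto $D$ and $R^2=R$) is sunny if $R(Rx+t(x-Rx))=Rx$ for all $x\in E$ and $t\ge0$, and is generalized nonexpansive if $\phi(Rx,p)\le\phi(x,p)$ for all $x\in E$, $p\in D$. A sunny generalized nonexpansive retraction onto $D$, when it exists, is unique; it is denoted $R_D$. The indices $n(\mathrm{mod}\,N)$ and $n(\mathrm{mod}\,L)$ take values in $\{1,\dots,N\}$ and $\{1,\dots,L\}$ respectively.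
   Formalization: R_B need not exist under these hypotheses (e.g. B a plane in R^3 with the l^4 norm), so what is proved is: x_n converges strongly to a point of B, and to R_B x whenever a sunny generalized nonexpansive retraction R_B onto B exists; the R_{C_{n+1}} are taken as given with the scheme. *)

theory Defs
  imports "HOL-Analysis.Analysis"
begin

type_synonym 'a dual = "'a \<Rightarrow>\<^sub>L real"

abbreviation pairing :: "'a::real_normed_vector \<Rightarrow> 'a dual \<Rightarrow> real"  (\<open>\<langle>_,/ _\<rangle>\<close>)
  where "\<langle>x, x'\<rangle> \<equiv> blinfun_apply x' x"

definition uniformly_convex_space :: "'a::real_normed_vector itself \<Rightarrow> bool" where
  "uniformly_convex_space _ \<longleftrightarrow>
     (\<forall>\<epsilon>. 0 < \<epsilon> \<and> \<epsilon> \<le> 2 \<longrightarrow>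
        (\<exists>\<delta>>0. \<forall>x y :: 'a. norm x = 1 \<and> norm y = 1 \<and> \<epsilon> \<le> norm (x - y) \<longrightarrow>
            norm ((1 / 2) *\<^sub>R (x + y)) \<le> 1 - \<delta>))"

text \<open>The condition \<open>\<rho>(t)/t \<rightarrow> 0\<close> as \<open>t \<rightarrow> 0\<close> on the modulus of smoothness
  \<open>\<rho>(t) = sup {(\<parallel>x + ty\<parallel> + \<parallel>x - ty\<parallel>)/2 - 1 | \<parallel>x\<parallel> = \<parallel>y\<parallel> = 1}\<close>, with the supremum written out
  (so that the zero space is not a special case).\<close>

definition uniformly_smooth_space :: "'a::real_normed_vector itself \<Rightarrow> bool" where
  "uniformly_smooth_space _ \<longleftrightarrow>
     (\<forall>\<epsilon>>0. \<exists>\<delta>>0. \<forall>t. 0 < t \<and> t < \<delta> \<longrightarrow>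
        (\<forall>x y :: 'a. norm x = 1 \<and> norm y = 1 \<longrightarrow>
            (norm (x + t *\<^sub>R y) + norm (x - t *\<^sub>R y)) / 2 - 1 \<le> \<epsilon> * t))"

definition duality_set :: "'a::real_normed_vector \<Rightarrow> 'a dual set" where
  "duality_set x = {x'. \<langle>x, x'\<rangle> = norm x * norm x' \<and> norm x = norm x'}"

text \<open>\<open>J\<close> and \<open>J\<^sub>*\<close> as single-valued maps; meaningful when every \<open>duality_set x\<close> is a singleton and
  \<open>J\<close> is bijective, as is the case for uniformly smooth and uniformly convex Banach spaces.\<close>

definition J :: "'a::real_normed_vector \<Rightarrow> 'a dual" where
  "J x = (THE x'. x' \<in> duality_set x)"

definition J_star :: "'a::real_normed_vector dual \<Rightarrow> 'a" where
  "J_star = inv J"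

definition lyapunov :: "'a::real_normed_vector \<Rightarrow> 'a \<Rightarrow> real"  (\<open>\<phi>\<close>) where
  "\<phi> x y = (norm x)\<^sup>2 - 2 * \<langle>x, J y\<rangle> + (norm y)\<^sup>2"

definition lsc_on :: "'b::topological_space set \<Rightarrow> ('b \<Rightarrow> real) \<Rightarrow> bool" where
  "lsc_on S g \<longleftrightarrow> (\<forall>x\<in>S. \<forall>c<g x. \<forall>\<^sub>F y in at x within S. c < g y)"

definition bifunction_A1 :: "'b set \<Rightarrow> ('b \<Rightarrow> 'b \<Rightarrow> real) \<Rightarrow> bool" where
  "bifunction_A1 D f \<longleftrightarrow> (\<forall>x\<in>D. f x x = 0)"

definition bifunction_A2 :: "'b set \<Rightarrow> ('b \<Rightarrow> 'b \<Rightarrow> real) \<Rightarrow> bool" where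
  "bifunction_A2 D f \<longleftrightarrow> (\<forall>x\<in>D. \<forall>y\<in>D. f x y + f y x \<le> 0)"

definition bifunction_A3 :: "'b::real_normed_vector set \<Rightarrow> ('b \<Rightarrow> 'b \<Rightarrow> real) \<Rightarrow> bool" where
  "bifunction_A3 D f \<longleftrightarrow>
     (\<forall>x\<in>D. \<forall>y\<in>D. \<forall>z\<in>D.
        Limsup (at_right 0) (\<lambda>t::real. ereal (f (t *\<^sub>R z + (1 - t) *\<^sub>R x) y)) \<le> ereal (f x y))"

definition bifunction_A4 :: "'b::real_normed_vector set \<Rightarrow> ('b \<Rightarrow> 'b \<Rightarrow> real) \<Rightarrow> bool" where
  "bifunction_A4 D f \<longleftrightarrow> (\<forall>x\<in>D. convex_on D (f x) \<and> lsc_on D (f x))"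

definition EP :: "'a::real_normed_vector set \<Rightarrow> ('a dual \<Rightarrow> 'a dual \<Rightarrow> real) \<Rightarrow> 'a set" where
  "EP C f = {x\<in>C. \<forall>y\<in>C. f (J x) (J y) \<ge> 0}"

definition VI :: "'a::real_normed_vector set \<Rightarrow> ('a \<Rightarrow> 'a dual) \<Rightarrow> 'a set" where
  "VI C A = {x\<in>C. \<forall>y\<in>C. \<langle>y - x, A x\<rangle> \<ge> 0}"

definition monotone_operator_on :: "'a::real_normed_vector set \<Rightarrow> ('a \<Rightarrow> 'a dual) \<Rightarrow> bool" where
  "monotone_operator_on C A \<longleftrightarrow> (\<forall>u\<in>C. \<forall>v\<in>C. \<langle>u - v, A u - A v\<rangle> \<ge> 0)"

definition J_fixed :: "'a::real_normed_vector set \<Rightarrow> ('a \<Rightarrow> 'a dual) \<Rightarrow> 'a set" where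
  "J_fixed C T = {x\<in>C. T x = J x}"

definition J_fixed_family :: "'a::real_normed_vector set \<Rightarrow> ('a \<Rightarrow> 'a dual) set \<Rightarrow> 'a set" where
  "J_fixed_family C \<Gamma> = (\<Inter>T\<in>\<Gamma>. J_fixed C T)"

definition gen_J_star_nonexpansive ::
    "'a::real_normed_vector set \<Rightarrow> ('a \<Rightarrow> 'a dual) \<Rightarrow> bool" where
  "gen_J_star_nonexpansive C T \<longleftrightarrow>
     J_fixed C T \<noteq> {} \<and> (\<forall>x\<in>C. \<forall>p\<in>J_fixed C T. \<phi> p ((J_star \<circ> T) x) \<le> \<phi> p x)"

definition J_star_closed :: "'a::real_normed_vector set \<Rightarrow> ('a \<Rightarrow> 'a dual) \<Rightarrow> bool" where
  "J_star_closed C T \<longleftrightarrow>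
     (\<forall>s x y. (\<forall>n::nat. s n \<in> C) \<and> s \<longlonglongrightarrow> x \<and> (\<lambda>n. (J_star \<circ> T) (s n)) \<longlonglongrightarrow> y
        \<longrightarrow> (J_star \<circ> T) x = y)"

text \<open>Sequences are indexed from 1; values at index 0 are irrelevant.\<close>

definition NST_condition ::
    "'a::real_normed_vector set \<Rightarrow> (nat \<Rightarrow> 'a \<Rightarrow> 'a dual) \<Rightarrow> ('a \<Rightarrow> 'a dual) set \<Rightarrow> bool" where
  "NST_condition C T \<Gamma> \<longleftrightarrow>
     (\<forall>s. (\<forall>n\<ge>1. s n \<in> C) \<and> bounded (s ` {1..}) \<and>
          (\<lambda>n. norm (J (s n) - T n (s n))) \<longlonglongrightarrow> 0
        \<longrightarrow> (\<forall>S\<in>\<Gamma>. (\<lambda>n. norm (J (s n) - S (s n))) \<longlonglongrightarrow> 0))"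

definition retraction_onto :: "'a::real_normed_vector set \<Rightarrow> ('a \<Rightarrow> 'a) \<Rightarrow> bool" where
  "retraction_onto D R \<longleftrightarrow> range R = D \<and> (\<forall>x. R (R x) = R x)"

definition sunny :: "('a::real_normed_vector \<Rightarrow> 'a) \<Rightarrow> bool" where
  "sunny R \<longleftrightarrow> (\<forall>x. \<forall>t\<ge>0. R (R x + t *\<^sub>R (x - R x)) = R x)"

definition gen_nonexpansive_onto :: "'a::real_normed_vector set \<Rightarrow> ('a \<Rightarrow> 'a) \<Rightarrow> bool" where
  "gen_nonexpansive_onto D R \<longleftrightarrow> (\<forall>x. \<forall>p\<in>D. \<phi> (R x) p \<le> \<phi> x p)"

definition sunny_gen_nonexp_retraction ::
    "'a::real_normed_vector set \<Rightarrow> ('a \<Rightarrow> 'a) \<Rightarrow> bool" where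
  "sunny_gen_nonexp_retraction D R \<longleftrightarrow>
     D \<noteq> {} \<and> closed D \<and> retraction_onto D R \<and> sunny R \<and> gen_nonexpansive_onto D R"

text \<open>The representative of \<open>n\<close> modulo \<open>N\<close> in \<open>{1..N}\<close>.\<close>

definition cyc :: "nat \<Rightarrow> nat \<Rightarrow> nat" where
  "cyc n N = (if n mod N = 0 then N else n mod N)"

end

theory Submission
  imports Defs
begin

text \<open>The three-point identity \<open>\<phi>(x,y) = \<phi>(x,z) + \<phi>(z,y) + 2\<langle>x - z, Jz - Jy\<rangle>\<close> drives the whole proof.
  Applied to the two resolvents \<open>z\<^sub>n\<close>, \<open>u\<^sub>n\<close> it yields, for \<open>p \<in> B\<close>,
  \<open>\<phi>(p,y\<^sub>n) + \<alpha>\<^sub>2 \<phi>(z\<^sub>n,x\<^sub>n) + \<alpha>\<^sub>3 \<phi>(u\<^sub>n,x\<^sub>n) \<le> \<phi>(p,x\<^sub>n)\<close>, so \<open>B\<close> lies in every \<open>C\<^sub>n\<close>. Applied to the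
  retractions it yields \<open>\<phi>(x,x\<^sub>n) + \<phi>(x\<^sub>n,y) \<le> \<phi>(x,y)\<close> for \<open>y \<in> C\<^sub>n\<close>, so \<open>\<phi>(x,x\<^sub>n)\<close> is increasing and
  bounded and, by uniform convexity, \<open>x\<^sub>n\<close> is Cauchy. As \<open>x\<^sub>n\<^sub>+\<^sub>1 \<in> C\<^sub>n\<^sub>+\<^sub>1\<close>, also \<open>y\<^sub>n\<close> and then \<open>z\<^sub>n\<close>, \<open>u\<^sub>n\<close> tend
  to the limit \<open>q\<close>, and passing to the limit in the defining relations places \<open>q\<close> in \<open>B\<close>.
  Finally \<open>\<phi>(x,q) \<le> \<phi>(x,R\<^sub>Bx) \<le> \<phi>(x,q) - \<phi>(R\<^sub>Bx,q)\<close> forces \<open>q = R\<^sub>Bx\<close>.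

  The Hahn-Banach theorem is not needed for the existence of \<open>J\<close>: smoothness makes the one-sided
  directional derivative of the norm linear, and \<open>Jx\<close> is a multiple of it.\<close>

section \<open>The duality map of a uniformly smooth space\<close>

definition norm_slope :: "'a::real_normed_vector \<Rightarrow> 'a \<Rightarrow> real \<Rightarrow> real" where
  "norm_slope x y t = (norm (x + t *\<^sub>R y) - norm x) / t"

text \<open>Convexity of the norm: \<open>x + s *\<^sub>R y\<close> lies on the segment from
  \<open>x\<close> to \<open>x + t *\<^sub>R y\<close>.\<close>

lemma norm_slope_mono:
  assumes "0 < s" "s \<le> t"
  shows "norm_slope x y s \<le> norm_slope x y t"
proof -
  have "x + s *\<^sub>R y = (1 - s / t) *\<^sub>R x + (s / t) *\<^sub>R (x + t *\<^sub>R y)"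
    using assms by (simp add: algebra_simps)
  then have "norm (x + s *\<^sub>R y) \<le> norm ((1 - s / t) *\<^sub>R x) + norm ((s / t) *\<^sub>R (x + t *\<^sub>R y))"
    by (metis norm_triangle_ineq)
  also have "\<dots> = (1 - s / t) * norm x + (s / t) * norm (x + t *\<^sub>R y)"
    using assms by simp
  finally show ?thesis
    using assms unfolding norm_slope_def by (simp add: field_simps)
qed

lemma abs_norm_slope_le:
  assumes "0 < t"
  shows "\<bar>norm_slope x y t\<bar> \<le> norm y"
proof -
  have "\<bar>norm (x + t *\<^sub>R y) - norm x\<bar> \<le> norm (t *\<^sub>R y)"
    using norm_triangle_ineq3[of "x + t *\<^sub>R y" x] by simp
  then show ?thesis
    using assms unfolding norm_slope_def by (simp add: field_simps abs_divide)
qed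

text \<open>The one-sided directional derivative: the slopes decrease with \<open>t\<close> and are
  bounded below, so the infimum is their limit as \<open>t\<close> falls to 0.\<close>

definition norm_deriv :: "'a::real_normed_vector \<Rightarrow> 'a \<Rightarrow> real" where
  "norm_deriv x y = (INF t\<in>{0<..}. norm_slope x y t)"

lemma norm_deriv_le_slope:
  assumes "0 < t"
  shows "norm_deriv x y \<le> norm_slope x y t"
  unfolding norm_deriv_def
proof (rule cINF_lower)
  show "bdd_below (norm_slope x y ` {0<..})"
    using abs_norm_slope_le[of _ x y] by (intro bdd_belowI[of _ "- norm y"]) (force simp: abs_le_iff)
qed (use assms in simp)

lemma le_norm_derivI:
  assumes "\<And>t. 0 < t \<Longrightarrow> b \<le> norm_slope x y t"
  shows "b \<le> norm_deriv x y"
  unfolding norm_deriv_def by (rule cINF_greatest) (use assms in auto)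

lemma norm_deriv_approx:
  assumes "norm_deriv x y < b"
  obtains t where "0 < t" "\<And>s. 0 < s \<Longrightarrow> s \<le> t \<Longrightarrow> norm_slope x y s < b"
proof -
  have "\<exists>t>0. norm_slope x y t < b"
    using le_norm_derivI[of b x y] assms by (meson not_le)
  then show thesis
    using that norm_slope_mono by (metis le_less_trans)
qed

text \<open>The point \<open>x + (t / 2) *\<^sub>R (y + z)\<close> is the midpoint of
  \<open>x + t *\<^sub>R y\<close> and \<open>x + t *\<^sub>R z\<close>.\<close>

lemma norm_deriv_add_le: "norm_deriv x (y + z) \<le> norm_deriv x y + norm_deriv x z"
proof (rule field_le_epsilon)
  fix e :: real assume "0 < e"
  then have "norm_deriv x y < norm_deriv x y + e / 2" "norm_deriv x z < norm_deriv x z + e / 2"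
    by simp_all
  then obtain t1 t2 where t1: "0 < t1" "\<And>s. 0 < s \<Longrightarrow> s \<le> t1 \<Longrightarrow> norm_slope x y s < norm_deriv x y + e / 2"
    and t2: "0 < t2" "\<And>s. 0 < s \<Longrightarrow> s \<le> t2 \<Longrightarrow> norm_slope x z s < norm_deriv x z + e / 2"
    by (metis norm_deriv_approx)
  define t where "t = min t1 t2"
  have t: "0 < t" "t \<le> t1" "t \<le> t2"
    using t1 t2 by (auto simp: t_def)
  have "2 *\<^sub>R (x + (t / 2) *\<^sub>R (y + z)) = (x + t *\<^sub>R y) + (x + t *\<^sub>R z)"
    by (simp add: algebra_simps scaleR_2)
  then have "norm (2 *\<^sub>R (x + (t / 2) *\<^sub>R (y + z))) \<le> norm (x + t *\<^sub>R y) + norm (x + t *\<^sub>R z)"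
    by (metis norm_triangle_ineq)
  then have "2 * norm (x + (t / 2) *\<^sub>R (y + z)) \<le> norm (x + t *\<^sub>R y) + norm (x + t *\<^sub>R z)"
    by (metis norm_scaleR abs_numeral)
  then have "(2 * norm (x + (t / 2) *\<^sub>R (y + z)) - 2 * norm x) / t
      \<le> (norm (x + t *\<^sub>R y) + norm (x + t *\<^sub>R z) - 2 * norm x) / t"
    using t by (intro divide_right_mono) auto
  then have "norm_slope x (y + z) (t / 2) \<le> norm_slope x y t + norm_slope x z t"
    by (simp add: norm_slope_def diff_divide_distrib add_divide_distrib mult.commute)
  then show "norm_deriv x (y + z) \<le> norm_deriv x y + norm_deriv x z + e"
    using norm_deriv_le_slope[of "t / 2" x "y + z"] t t1(2)[of t] t2(2)[of t] by simp
qed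

text \<open>Rescaling the step gives one inequality for every positive factor; the factor
  \<open>inverse c\<close> turns it into the other.\<close>

lemma norm_deriv_scale_pos:
  assumes "0 < c"
  shows "norm_deriv x (c *\<^sub>R y) = c * norm_deriv x y"
proof -
  have ge: "c * norm_deriv x y \<le> norm_deriv x (c *\<^sub>R y)" if "0 < c" for c y
  proof (rule le_norm_derivI)
    fix t :: real assume "0 < t"
    then have "norm_slope x (c *\<^sub>R y) t = c * norm_slope x y (c * t)"
      using that by (simp add: norm_slope_def mult.commute)
    then show "c * norm_deriv x y \<le> norm_slope x (c *\<^sub>R y) t"
      using norm_deriv_le_slope[of "c * t" x y] that \<open>0 < t\<close> by simp
  qed
  have "inverse c * norm_deriv x (c *\<^sub>R y) \<le> norm_deriv x y"
    using ge[of "inverse c" "c *\<^sub>R y"] assms by simp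
  then have "norm_deriv x (c *\<^sub>R y) \<le> c * norm_deriv x y"
    using assms by (simp add: field_simps)
  with ge[OF assms, of y] show ?thesis by simp
qed

lemma norm_deriv_zero: "norm_deriv x 0 = 0"
  unfolding norm_deriv_def norm_slope_def by simp

lemma abs_norm_deriv_le: "\<bar>norm_deriv x y\<bar> \<le> norm y"
  using le_norm_derivI[of "- norm y" x y] norm_deriv_le_slope[of 1 x y] abs_norm_slope_le[of _ x y]
  by (smt (verit))

text \<open>Smoothness makes the slopes in the directions \<open>u\<close> and \<open>- u\<close>
  sum to at most \<open>e\<close> for small steps; subadditivity gives the opposite
  inequality.\<close>

lemma norm_deriv_minus:
  fixes x :: "'a::real_normed_vector"
  assumes us: "uniformly_smooth_space TYPE('a)" and x: "norm x = 1"
  shows "norm_deriv x (- y) = - norm_deriv x y"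
proof -
  have unit: "norm_deriv x u + norm_deriv x (- u) \<le> 0" if "norm u = 1" for u
  proof (rule field_le_epsilon)
    fix e :: real assume "0 < e"
    then obtain d where "0 < d" and d: "\<And>t x y :: 'a. 0 < t \<Longrightarrow> t < d \<Longrightarrow> norm x = 1 \<Longrightarrow> norm y = 1 \<Longrightarrow>
        (norm (x + t *\<^sub>R y) + norm (x - t *\<^sub>R y)) / 2 - 1 \<le> e / 2 * t"
      using us unfolding uniformly_smooth_space_def by (metis half_gt_zero)
    then obtain t where t: "0 < t" "t < d"
      using dense by blast
    have "norm_slope x u t + norm_slope x (- u) t = (norm (x + t *\<^sub>R u) + norm (x - t *\<^sub>R u) - 2) / t"
      using x by (simp add: norm_slope_def diff_divide_distrib add_divide_distrib)
    also have "\<dots> \<le> e"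
      using d[OF t x that] t by (simp add: pos_divide_le_eq field_simps)
    finally show "norm_deriv x u + norm_deriv x (- u) \<le> 0 + e"
      using norm_deriv_le_slope[OF t(1), of x u] norm_deriv_le_slope[OF t(1), of x "- u"] by simp
  qed
  have "norm_deriv x y + norm_deriv x (- y) \<le> 0"
  proof (cases "y = 0")
    case False
    then have "norm_deriv x y = norm y * norm_deriv x (sgn y)"
      "norm_deriv x (- y) = norm y * norm_deriv x (- sgn y)"
      using norm_deriv_scale_pos[of "norm y" x "sgn y"] norm_deriv_scale_pos[of "norm y" x "- sgn y"]
      by (simp_all add: sgn_div_norm)
    then show ?thesis
      using unit[of "sgn y"] False
      by (simp add: norm_sgn mult_nonneg_nonpos flip: distrib_left)
  qed (simp add: norm_deriv_zero)
  moreover have "0 \<le> norm_deriv x y + norm_deriv x (- y)"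
    using norm_deriv_add_le[of x y "- y"] by (simp add: norm_deriv_zero)
  ultimately show ?thesis by linarith
qed

text \<open>A subadditive odd function is additive: write \<open>y\<close> as
  \<open>(y + z) + (- z)\<close>.\<close>

lemma bounded_linear_norm_deriv:
  fixes x :: "'a::real_normed_vector"
  assumes us: "uniformly_smooth_space TYPE('a)" and x: "norm x = 1"
  shows "bounded_linear (norm_deriv x)"
proof (rule bounded_linear_intro[where K = 1])
  show "norm_deriv x (y + z) = norm_deriv x y + norm_deriv x z" for y z
    using norm_deriv_add_le[of x y z] norm_deriv_add_le[of x "y + z" "- z"]
      norm_deriv_minus[OF assms, of z] by simp
  show "norm_deriv x (c *\<^sub>R y) = c *\<^sub>R norm_deriv x y" for c y
  proof -
    consider "c = 0" | "0 < c" | "0 < - c" by linarith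
    then show ?thesis
    proof cases
      case 3
      then show ?thesis
        using norm_deriv_scale_pos[of "- c" x y] norm_deriv_minus[OF assms, of "c *\<^sub>R y"] by simp
    qed (simp_all add: norm_deriv_zero norm_deriv_scale_pos)
  qed
  show "norm (norm_deriv x y) \<le> norm y * 1" for y
    using abs_norm_deriv_le[of x y] by simp
qed

lemma duality_set_scaleR:
  assumes "x' \<in> duality_set x" "0 \<le> c"
  shows "c *\<^sub>R x' \<in> duality_set (c *\<^sub>R x)"
  using assms by (simp add: duality_set_def blinfun.scaleR_right blinfun.scaleR_left)

text \<open>At a unit vector the derivative of the norm is a functional of norm one with value 1
  there; scaling carries it to every nonzero vector.\<close>

lemma duality_set_nonempty:
  fixes x :: "'a::real_normed_vector"
  assumes us: "uniformly_smooth_space TYPE('a)"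
  shows "duality_set x \<noteq> {}"
proof (cases "x = 0")
  case True
  then have "0 \<in> duality_set x"
    by (simp add: duality_set_def)
  then show ?thesis by blast
next
  case False
  define u where "u = sgn x"
  have u: "norm u = 1"
    using False by (simp add: u_def norm_sgn)
  define u' where "u' = Blinfun (norm_deriv u)"
  have app: "blinfun_apply u' = norm_deriv u"
    unfolding u'_def by (rule bounded_linear_Blinfun_apply[OF bounded_linear_norm_deriv[OF us u]])
  have "norm_slope u u t = 1" if "0 < t" for t
  proof -
    have "u + t *\<^sub>R u = (1 + t) *\<^sub>R u"
      by (simp add: algebra_simps)
    then show ?thesis
      using that u by (simp add: norm_slope_def)
  qed
  then have "1 \<le> norm_deriv u u"
    by (intro le_norm_derivI) simp
  then have u'u: "\<langle>u, u'\<rangle> = 1"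
    using abs_norm_deriv_le[of u u] u app by simp
  moreover have "norm u' \<le> 1"
    using abs_norm_deriv_le[of u] by (intro norm_blinfun_bound) (simp_all add: app)
  moreover have "1 \<le> norm u'"
    using norm_blinfun[of u' u] u u'u by simp
  ultimately have "u' \<in> duality_set u"
    using u by (simp add: duality_set_def)
  from duality_set_scaleR[OF this, of "norm x"] have "norm x *\<^sub>R u' \<in> duality_set x"
    using False by (simp add: u_def sgn_div_norm)
  then show ?thesis by blast
qed

lemma norm_blinfun_le_unit:
  fixes w :: "'a::real_normed_vector dual"
  assumes "0 \<le> c" and le: "\<And>h. norm h = 1 \<Longrightarrow> \<langle>h, w\<rangle> \<le> c"
  shows "norm w \<le> c"
proof (rule norm_blinfun_bound[OF \<open>0 \<le> c\<close>])
  fix h :: 'a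
  show "norm \<langle>h, w\<rangle> \<le> c * norm h"
  proof (cases "h = 0")
    case False
    then have n: "norm (sgn h) = 1" "norm (- sgn h) = 1"
      by (simp_all add: norm_sgn)
    have "\<bar>\<langle>sgn h, w\<rangle>\<bar> \<le> c"
      using le[OF n(1)] le[OF n(2)] by (simp add: blinfun.minus_right)
    then have "\<bar>\<langle>sgn h, w\<rangle>\<bar> * norm h \<le> c * norm h"
      by (rule mult_right_mono) simp
    moreover have "\<langle>h, w\<rangle> = norm h * \<langle>sgn h, w\<rangle>"
      using False by (simp add: sgn_div_norm blinfun.scaleR_right)
    ultimately show ?thesis
      by (simp add: abs_mult mult.commute)
  qed simp
qed

text \<open>With \<open>x = y\<close> this says that the duality map is single-valued, in general that it is uniformly
  continuous on the unit sphere. The reason is that \<open>\<parallel>x + th\<parallel> + \<parallel>x - th\<parallel> \<ge> \<langle>x + th, x'\<rangle> + \<langle>x - th, y'\<rangle>\<close>.\<close>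

lemma duality_set_unit_close:
  assumes us: "uniformly_smooth_space TYPE('a::real_normed_vector)" and "0 < e"
  obtains d where "0 < d"
    "\<And>(x::'a) y x' y'. norm x = 1 \<Longrightarrow> norm y = 1 \<Longrightarrow> x' \<in> duality_set x \<Longrightarrow> y' \<in> duality_set y
       \<Longrightarrow> norm (x - y) < d \<Longrightarrow> norm (x' - y') \<le> e"
proof -
  obtain d where "0 < d" and d: "\<And>t x y :: 'a. 0 < t \<Longrightarrow> t < d \<Longrightarrow> norm x = 1 \<Longrightarrow> norm y = 1 \<Longrightarrow>
      (norm (x + t *\<^sub>R y) + norm (x - t *\<^sub>R y)) / 2 - 1 \<le> e / 4 * t"
    using us \<open>0 < e\<close> unfolding uniformly_smooth_space_def by (metis divide_pos_pos zero_less_numeral)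
  define t where "t = d / 2"
  have t: "0 < t" "t < d"
    using \<open>0 < d\<close> by (auto simp: t_def)
  show thesis
  proof (rule that)
    \<comment> \<open>The errors add up to \<open>t * e\<close>: half from
      \<open>norm (x - y)\<close>, half from smoothness, whose \<open>e / 4\<close> is doubled when
      the average is cleared.\<close>
    show "0 < e / 2 * t"
      using \<open>0 < e\<close> t by simp
    fix x y :: 'a and x' y'
    assume x: "norm x = 1" and y: "norm y = 1" and x': "x' \<in> duality_set x"
      and y': "y' \<in> duality_set y" and xy: "norm (x - y) < e / 2 * t"
    have nx': "norm x' = 1" "\<langle>x, x'\<rangle> = 1" and ny': "norm y' = 1" "\<langle>y, y'\<rangle> = 1"
      using x y x' y' by (auto simp: duality_set_def)
    have le: "\<langle>h, x' - y'\<rangle> \<le> e" if h: "norm h = 1" for h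
    proof -
      have "\<langle>x + t *\<^sub>R h, x'\<rangle> \<le> norm (x + t *\<^sub>R h)"
        using norm_blinfun[of x' "x + t *\<^sub>R h"] nx' by simp
      moreover have "\<langle>x - t *\<^sub>R h, y'\<rangle> \<le> norm (x - t *\<^sub>R h)"
        using norm_blinfun[of y' "x - t *\<^sub>R h"] ny' by simp
      moreover have "\<langle>y - x, y'\<rangle> \<le> norm (x - y)"
        using norm_blinfun[of y' "y - x"] ny' by (simp add: norm_minus_commute)
      moreover have "(norm (x + t *\<^sub>R h) + norm (x - t *\<^sub>R h)) / 2 - 1 \<le> e / 4 * t"
        by (rule d[OF t x h])
      ultimately have "t * \<langle>h, x' - y'\<rangle> \<le> t * e"
        using xy nx' ny'
        by (simp add: blinfun.add_right blinfun.diff_right blinfun.diff_left blinfun.scaleR_right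
            algebra_simps)
      then show ?thesis
        using t by simp
    qed
    show "norm (x' - y') \<le> e"
      using le \<open>0 < e\<close> by (intro norm_blinfun_le_unit) simp_all
  qed
qed

lemma duality_set_unique:
  fixes x :: "'a::real_normed_vector"
  assumes us: "uniformly_smooth_space TYPE('a)" and "x' \<in> duality_set x" "y' \<in> duality_set x"
  shows "x' = y'"
proof (cases "x = 0")
  case True
  then show ?thesis
    using assms by (simp add: duality_set_def)
next
  case False
  define c where "c = inverse (norm x)"
  have c: "0 < c" "norm (c *\<^sub>R x) = 1"
    using False by (auto simp: c_def)
  have "norm (c *\<^sub>R x' - c *\<^sub>R y') \<le> 0 + e" if "0 < e" for e
    using duality_set_unit_close[OF us that] c assms(2,3)
    by (smt (verit) duality_set_scaleR norm_zero right_minus_eq)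
  then have "norm (c *\<^sub>R x' - c *\<^sub>R y') \<le> 0"
    by (rule field_le_epsilon)
  then show ?thesis
    using c by simp
qed

lemma J_in_duality_set:
  fixes x :: "'a::real_normed_vector"
  assumes us: "uniformly_smooth_space TYPE('a)"
  shows "J x \<in> duality_set x"
  unfolding J_def
  by (rule theI') (use duality_set_nonempty[OF us] duality_set_unique[OF us] in blast)

lemma J_eqI:
  fixes x :: "'a::real_normed_vector"
  assumes us: "uniformly_smooth_space TYPE('a)" and "x' \<in> duality_set x"
  shows "J x = x'"
  using duality_set_unique[OF us J_in_duality_set[OF us] assms(2)] .

lemma norm_J:
  fixes x :: "'a::real_normed_vector"
  assumes us: "uniformly_smooth_space TYPE('a)"
  shows "norm (J x) = norm x"
  using J_in_duality_set[OF us, of x] by (simp add: duality_set_def)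

lemma pairing_J_self:
  fixes x :: "'a::real_normed_vector"
  assumes us: "uniformly_smooth_space TYPE('a)"
  shows "\<langle>x, J x\<rangle> = (norm x)\<^sup>2"
  using J_in_duality_set[OF us, of x] by (simp add: duality_set_def power2_eq_square)

lemma J_scaleR:
  fixes x :: "'a::real_normed_vector"
  assumes us: "uniformly_smooth_space TYPE('a)" and "0 \<le> c"
  shows "J (c *\<^sub>R x) = c *\<^sub>R J x"
  by (rule J_eqI[OF us duality_set_scaleR[OF J_in_duality_set[OF us] assms(2)]])

text \<open>At a nonzero limit: normalise, use uniform continuity on the unit sphere, restore the
  length by homogeneity. At zero, norm preservation suffices.\<close>

lemma tendsto_J:
  fixes x :: "'a::real_normed_vector"
  assumes us: "uniformly_smooth_space TYPE('a)" and s: "s \<longlonglongrightarrow> x"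
  shows "(\<lambda>n. J (s n)) \<longlonglongrightarrow> J x"
proof (cases "x = 0")
  case True
  then have "(\<lambda>n. norm (s n)) \<longlonglongrightarrow> 0"
    using s by (simp add: tendsto_norm_zero)
  then have "(\<lambda>n. J (s n)) \<longlonglongrightarrow> 0"
    by (simp add: tendsto_norm_zero_iff norm_J[OF us] flip: tendsto_norm_zero_iff[of "\<lambda>n. J (s n)"])
  moreover have "J x = 0"
    using True norm_J[OF us, of x] by simp
  ultimately show ?thesis by simp
next
  case False
  have sgn_conv: "(\<lambda>n. sgn (s n)) \<longlonglongrightarrow> sgn x"
    by (rule tendsto_sgn[OF s False])
  have nz: "\<forall>\<^sub>F n in sequentially. s n \<noteq> 0"
    using s False by (rule tendsto_imp_eventually_ne)
  have "(\<lambda>n. J (sgn (s n))) \<longlonglongrightarrow> J (sgn x)"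
  proof (rule tendstoI)
    fix e :: real assume "0 < e"
    then have "0 < e / 2" by simp
    from duality_set_unit_close[OF us this] obtain d where "0 < d" and
      d: "\<And>(x::'a) y x' y'. norm x = 1 \<Longrightarrow> norm y = 1 \<Longrightarrow> x' \<in> duality_set x \<Longrightarrow> y' \<in> duality_set y
       \<Longrightarrow> norm (x - y) < d \<Longrightarrow> norm (x' - y') \<le> e / 2"
      by blast
    have "\<forall>\<^sub>F n in sequentially. dist (sgn (s n)) (sgn x) < d"
      using sgn_conv \<open>0 < d\<close> by (rule tendstoD)
    with nz show "\<forall>\<^sub>F n in sequentially. dist (J (sgn (s n))) (J (sgn x)) < e"
    proof eventually_elim
      case (elim n)
      have "norm (J (sgn (s n)) - J (sgn x)) \<le> e / 2"
        by (rule d[of "sgn (s n)" "sgn x"])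
          (use elim False in \<open>simp_all add: norm_sgn J_in_duality_set[OF us] dist_norm\<close>)
      then show ?case
        using \<open>0 < e\<close> by (simp add: dist_norm)
    qed
  qed
  then have "(\<lambda>n. norm (s n) *\<^sub>R J (sgn (s n))) \<longlonglongrightarrow> norm x *\<^sub>R J (sgn x)"
    by (intro tendsto_intros s)
  moreover have "norm z *\<^sub>R J (sgn z) = J z" for z :: 'a
    using J_scaleR[OF us, of "norm z" "sgn z"] by (cases "z = 0") (simp_all add: sgn_div_norm)
  ultimately show ?thesis by simp
qed


section \<open>The Lyapunov functional and uniform convexity\<close>

lemma lyapunov_three_point:
  fixes x :: "'a::real_normed_vector"
  assumes us: "uniformly_smooth_space TYPE('a)"
  shows "\<phi> x y = \<phi> x z + \<phi> z y + 2 * \<langle>x - z, J z - J y\<rangle>"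
  using pairing_J_self[OF us, of z]
  by (simp add: lyapunov_def blinfun.diff_left blinfun.diff_right algebra_simps)

lemma lyapunov_ge:
  fixes x :: "'a::real_normed_vector"
  assumes us: "uniformly_smooth_space TYPE('a)"
  shows "(norm x - norm y)\<^sup>2 \<le> \<phi> x y"
proof -
  have "\<langle>x, J y\<rangle> \<le> norm x * norm y"
    using norm_blinfun[of "J y" x] norm_J[OF us, of y] by (simp add: mult.commute)
  then show ?thesis
    by (simp add: lyapunov_def power2_diff)
qed

lemma lyapunov_nonneg:
  fixes x :: "'a::real_normed_vector"
  assumes us: "uniformly_smooth_space TYPE('a)"
  shows "0 \<le> \<phi> x y"
  using lyapunov_ge[OF us, of x y] zero_le_power2 order_trans by blast

lemma lyapunov_self:
  fixes x :: "'a::real_normed_vector"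
  assumes us: "uniformly_smooth_space TYPE('a)"
  shows "\<phi> x x = 0"
  by (simp add: lyapunov_def pairing_J_self[OF us])

lemma tendsto_lyapunov:
  fixes x :: "'a::real_normed_vector"
  assumes us: "uniformly_smooth_space TYPE('a)" and "s \<longlonglongrightarrow> x" "t \<longlonglongrightarrow> y"
  shows "(\<lambda>n. \<phi> (s n) (t n)) \<longlonglongrightarrow> \<phi> x y"
  unfolding lyapunov_def by (intro tendsto_intros blinfun.tendsto tendsto_J[OF us] assms)

lemma uniformly_convex_unit_close:
  assumes uc: "uniformly_convex_space TYPE('a::real_normed_vector)" and "0 < e"
  obtains d where "0 < d"
    "\<And>x y :: 'a. norm x = 1 \<Longrightarrow> norm y = 1 \<Longrightarrow> 2 - d < norm (x + y) \<Longrightarrow> norm (x - y) < e"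
proof -
  have "0 < min e 2 \<and> min e 2 \<le> 2"
    using \<open>0 < e\<close> by simp
  then obtain d where "0 < d" and d: "\<And>x y :: 'a. norm x = 1 \<Longrightarrow> norm y = 1 \<Longrightarrow> min e 2 \<le> norm (x - y)
      \<Longrightarrow> norm ((1 / 2) *\<^sub>R (x + y)) \<le> 1 - d"
    using uc unfolding uniformly_convex_space_def by meson
  show thesis
  proof (rule that)
    show "0 < 2 * d" using \<open>0 < d\<close> by simp
    fix x y :: 'a
    assume "norm x = 1" "norm y = 1" "2 - 2 * d < norm (x + y)"
    then show "norm (x - y) < e"
      using d[of x y] by (cases "e \<le> norm (x - y)") (auto simp: min_le_iff_disj)
  qed
qed

text \<open>A small value makes the norms close. If one norm is small, so is the other; otherwise
  the directions \<open>u\<close>, \<open>v\<close> have \<open>\<langle>u, J v\<rangle>\<close>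
  near 1, so \<open>norm (u + v)\<close> is near 2 and uniform convexity applies. The disjunction
  lets either argument carry the bound.\<close>

lemma lyapunov_small_imp_close:
  assumes us: "uniformly_smooth_space TYPE('a::real_normed_vector)"
    and uc: "uniformly_convex_space TYPE('a)" and "0 < e" "0 \<le> M"
  obtains d where "0 < d"
    "\<And>x y :: 'a. norm x \<le> M \<or> norm y \<le> M \<Longrightarrow> \<phi> x y < d \<Longrightarrow> norm (x - y) < e"
proof -
  \<comment> \<open>Both cases below end under \<open>3 * h\<close>: either the norms are below
    \<open>h\<close> and \<open>2 * h\<close> in some order, or the distance is at most
    \<open>e / 2\<close> plus the gap of the norms.\<close>
  define h where "h = e / 4"
  have h: "0 < h" using \<open>0 < e\<close> by (simp add: h_def)
  \<comment> \<open>This bounds \<open>norm x\<close> even when only \<open>norm y\<close> is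
    bounded by \<open>M\<close>.\<close>
  define K where "K = M + h"
  have K: "0 < K" using h \<open>0 \<le> M\<close> by (simp add: K_def)
  have "0 < e / (2 * K)" using \<open>0 < e\<close> K by simp
  from uniformly_convex_unit_close[OF uc this] obtain d1 where "0 < d1" and d1:
    "\<And>x y :: 'a. norm x = 1 \<Longrightarrow> norm y = 1 \<Longrightarrow> 2 - d1 < norm (x + y) \<Longrightarrow> norm (x - y) < e / (2 * K)"
    by blast
  show thesis
  proof (rule that)
    show "0 < min (h\<^sup>2) (2 * h\<^sup>2 * d1)"
      using h \<open>0 < d1\<close> by simp
    fix x y :: 'a
    assume M: "norm x \<le> M \<or> norm y \<le> M" and small: "\<phi> x y < min (h\<^sup>2) (2 * h\<^sup>2 * d1)"
    have "(norm x - norm y)\<^sup>2 < h\<^sup>2"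
      using lyapunov_ge[OF us, of x y] small by simp
    then have diff: "\<bar>norm x - norm y\<bar> < h"
      using h abs_le_square_iff[of h "norm x - norm y"] by linarith
    have xK: "norm x \<le> K"
      using M diff h by (auto simp: K_def)
    show "norm (x - y) < e"
    proof (cases "norm x < h \<or> norm y < h")
      case True
      then show ?thesis
        using diff norm_triangle_ineq4[of x y] unfolding h_def by linarith
    next
      case False
      then have pos: "h \<le> norm x" "h \<le> norm y" "0 < norm x" "0 < norm y"
        using h by auto
      have prod: "h\<^sup>2 \<le> norm x * norm y"
        using pos h by (simp add: power2_eq_square mult_mono)
      define u v where "u = sgn x" and "v = sgn y"
      have uv: "norm u = 1" "norm v = 1" "x = norm x *\<^sub>R u" "y = norm y *\<^sub>R v"
        using pos by (auto simp: u_def v_def norm_sgn sgn_div_norm)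
      have "\<langle>x, J y\<rangle> = \<langle>norm x *\<^sub>R u, J (norm y *\<^sub>R v)\<rangle>"
        by (simp only: uv(3,4)[symmetric])
      also have "\<dots> = norm x * norm y * \<langle>u, J v\<rangle>"
        by (simp add: J_scaleR[OF us] blinfun.scaleR_left blinfun.scaleR_right)
      \<comment> \<open>The two sides differ by \<open>(norm x - norm y)\<^sup>2\<close>.\<close>
      finally have "2 * (norm x * norm y) * (1 - \<langle>u, J v\<rangle>) \<le> \<phi> x y"
        using zero_le_power2[of "norm x - norm y"] by (simp add: lyapunov_def power2_diff algebra_simps)
      also have "\<phi> x y < 2 * h\<^sup>2 * d1"
        using small by simp
      also have "\<dots> \<le> 2 * (norm x * norm y) * d1"
        using prod \<open>0 < d1\<close> by simp
      finally have "1 - \<langle>u, J v\<rangle> < d1"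
        using pos by (simp add: mult_less_cancel_left_pos)
      moreover have "\<langle>u + v, J v\<rangle> \<le> norm (u + v)"
        using norm_blinfun[of "J v" "u + v"] norm_J[OF us, of v] uv by simp
      ultimately have "norm (u - v) < e / (2 * K)"
        using uv pairing_J_self[OF us, of v] by (intro d1) (simp_all add: blinfun.add_right)
      then have "norm x * norm (u - v) \<le> K * (e / (2 * K))"
        using xK K by (intro mult_mono) auto
      moreover have "norm (x - y) \<le> norm x * norm (u - v) + \<bar>norm x - norm y\<bar>"
      proof -
        have "x - y = norm x *\<^sub>R (u - v) + (norm x - norm y) *\<^sub>R v"
          using uv(3,4) by (simp add: algebra_simps)
        then have "norm (x - y) \<le> norm (norm x *\<^sub>R (u - v)) + norm ((norm x - norm y) *\<^sub>R v)"
          by (metis norm_triangle_ineq)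
        then show ?thesis
          using uv by simp
      qed
      ultimately show ?thesis
        using K diff \<open>0 < e\<close> by (simp add: h_def)
    qed
  qed
qed

lemma lyapunov_eq_0_imp_eq:
  fixes x :: "'a::real_normed_vector"
  assumes us: "uniformly_smooth_space TYPE('a)" and uc: "uniformly_convex_space TYPE('a)"
    and "\<phi> x y = 0"
  shows "x = y"
proof -
  have "norm (x - y) \<le> 0 + e" if "0 < e" for e
    using lyapunov_small_imp_close[OF us uc that, of "norm x"] assms(3)
    by (smt (verit) norm_ge_zero)
  then have "norm (x - y) \<le> 0"
    by (rule field_le_epsilon)
  then show ?thesis by simp
qed

lemma lyapunov_tendsto_0_imp_diff_tendsto_0:
  fixes s t :: "nat \<Rightarrow> 'a::real_normed_vector"
  assumes us: "uniformly_smooth_space TYPE('a)" and uc: "uniformly_convex_space TYPE('a)"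
    and lim: "(\<lambda>n. \<phi> (s n) (t n)) \<longlonglongrightarrow> 0"
    and bnd: "bounded (range s) \<or> bounded (range t)"
  shows "(\<lambda>n. s n - t n) \<longlonglongrightarrow> 0"
proof (rule tendstoI)
  fix e :: real assume "0 < e"
  obtain M where M: "0 \<le> M" "\<And>n. norm (s n) \<le> M \<or> norm (t n) \<le> M"
    using bnd by (metis bounded_pos rangeI less_imp_le)
  obtain d where "0 < d" and
    d: "\<And>x y :: 'a. norm x \<le> M \<or> norm y \<le> M \<Longrightarrow> \<phi> x y < d \<Longrightarrow> norm (x - y) < e"
    using lyapunov_small_imp_close[OF us uc \<open>0 < e\<close> M(1)] by blast
  have "\<forall>\<^sub>F n in sequentially. \<phi> (s n) (t n) < d"
    using order_tendstoD(2)[OF lim \<open>0 < d\<close>] .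
  then show "\<forall>\<^sub>F n in sequentially. dist (s n - t n) 0 < e"
    by eventually_elim (use d M in auto)
qed

lemma inj_J:
  assumes us: "uniformly_smooth_space TYPE('a::real_normed_vector)"
    and uc: "uniformly_convex_space TYPE('a)"
  shows "inj (J :: 'a \<Rightarrow> 'a dual)"
proof (rule injI)
  fix x y :: 'a assume eq: "J x = J y"
  then have "\<phi> x y = \<phi> x x"
    using norm_J[OF us, of x] norm_J[OF us, of y] by (simp add: lyapunov_def)
  then show "x = y"
    using lyapunov_eq_0_imp_eq[OF us uc] lyapunov_self[OF us] by metis
qed

text \<open>Take a maximising sequence of unit vectors: sums of late terms pair with
  \<open>x'\<close> close to 2, hence have norm close to 2, so the sequence is Cauchy by uniform
  convexity and completeness gives a maximiser.\<close>

lemma unit_functional_attains_norm: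
  fixes x' :: "'a::banach dual"
  assumes uc: "uniformly_convex_space TYPE('a)" and x': "norm x' = 1"
  obtains x where "norm x = 1" "\<langle>x, x'\<rangle> = 1"
proof -
  have "\<exists>x. norm x = 1 \<and> c < \<langle>x, x'\<rangle>" if "c < 1" "0 \<le> c" for c
  proof (rule ccontr)
    assume "\<not> ?thesis"
    then have le: "\<langle>x, x'\<rangle> \<le> c" if "norm x = 1" for x
      using that by (meson not_le)
    have "norm x' \<le> c"
      using le that by (intro norm_blinfun_le_unit) simp_all
    then show False
      using x' that by simp
  qed
  then have "\<exists>x. norm x = 1 \<and> 1 - 1 / real (Suc n) < \<langle>x, x'\<rangle>" for n
    by simp
  then obtain s where s: "\<And>n. norm (s n) = 1" "\<And>n. 1 - 1 / real (Suc n) < \<langle>s n, x'\<rangle>"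
    by metis
  have "Cauchy s"
  proof (rule metric_CauchyI)
    fix e :: real assume "0 < e"
    from uniformly_convex_unit_close[OF uc this] obtain d where "0 < d" and d:
      "\<And>x y :: 'a. norm x = 1 \<Longrightarrow> norm y = 1 \<Longrightarrow> 2 - d < norm (x + y) \<Longrightarrow> norm (x - y) < e"
      by blast
    obtain k where k: "1 / real (Suc k) < d / 2"
      using reals_Archimedean[of "d / 2"] \<open>0 < d\<close> by (auto simp: inverse_eq_divide)
    have "dist (s m) (s n) < e" if "k \<le> m" "k \<le> n" for m n
    proof -
      have "1 / real (Suc m) \<le> 1 / real (Suc k)" "1 / real (Suc n) \<le> 1 / real (Suc k)"
        using that by (simp_all add: frac_le)
      then have "2 - d < \<langle>s m + s n, x'\<rangle>"
        using s(2)[of m] s(2)[of n] k by (simp add: blinfun.add_right)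
      also have "\<dots> \<le> norm (s m + s n)"
        using norm_blinfun[of x' "s m + s n"] x' by simp
      finally show ?thesis
        using d[OF s(1) s(1)] by (simp add: dist_norm)
    qed
    then show "\<exists>M. \<forall>m\<ge>M. \<forall>n\<ge>M. dist (s m) (s n) < e" by blast
  qed
  then obtain x where x: "s \<longlonglongrightarrow> x"
    using Cauchy_convergent convergent_def by blast
  have nx: "norm x = 1"
    using tendsto_norm[OF x] s(1) by (simp add: LIMSEQ_const_iff)
  have "(\<lambda>n. \<langle>s n, x'\<rangle>) \<longlonglongrightarrow> \<langle>x, x'\<rangle>"
    by (intro blinfun.tendsto tendsto_const x)
  moreover have "(\<lambda>n. 1 - 1 / real (Suc n)) \<longlonglongrightarrow> 1 - 0"
    by (intro tendsto_intros lim_1_over_n[THEN LIMSEQ_Suc])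
  ultimately have "1 - 0 \<le> \<langle>x, x'\<rangle>"
    using s(2) by (meson LIMSEQ_le less_imp_le)
  moreover have "\<langle>x, x'\<rangle> \<le> 1"
    using norm_blinfun[of x' x] x' nx by simp
  ultimately show thesis
    using that nx by force
qed

text \<open>A preimage of a nonzero \<open>x'\<close> is a unit vector at which
  \<open>sgn x'\<close> attains its norm, scaled by \<open>norm x'\<close>.\<close>

lemma surj_J:
  assumes us: "uniformly_smooth_space TYPE('a::banach)" and uc: "uniformly_convex_space TYPE('a)"
  shows "surj (J :: 'a \<Rightarrow> 'a dual)"
proof (rule surjI)
  fix x' :: "'a dual"
  have "\<exists>x. J x = x'"
  proof (cases "x' = 0")
    case True
    then show ?thesis
      using norm_J[OF us, of 0] by (intro exI[of _ 0]) simp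
  next
    case False
    then have n: "norm (sgn x') = 1"
      by (simp add: norm_sgn)
    obtain u where u: "norm u = 1" "\<langle>u, sgn x'\<rangle> = 1"
      using unit_functional_attains_norm[OF uc n] by blast
    then have "J u = sgn x'"
      using n by (intro J_eqI[OF us]) (simp add: duality_set_def)
    then have "J (norm x' *\<^sub>R u) = x'"
      using False by (simp add: J_scaleR[OF us] sgn_div_norm)
    then show ?thesis by blast
  qed
  then show "J (SOME x. J x = x') = x'"
    by (rule someI_ex)
qed

lemma J_J_star:
  fixes w :: "'a::banach dual"
  assumes us: "uniformly_smooth_space TYPE('a)" and uc: "uniformly_convex_space TYPE('a)"
  shows "J (J_star w) = w"
  unfolding J_star_def by (rule surj_f_inv_f[OF surj_J[OF us uc]])

lemma J_star_J:
  fixes x :: "'a::real_normed_vector"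
  assumes us: "uniformly_smooth_space TYPE('a)" and uc: "uniformly_convex_space TYPE('a)"
  shows "J_star (J x) = x"
  unfolding J_star_def by (rule inv_f_f[OF inj_J[OF us uc]])

lemma lyapunov_J_star:
  fixes p :: "'a::banach"
  assumes us: "uniformly_smooth_space TYPE('a)" and uc: "uniformly_convex_space TYPE('a)"
  shows "\<phi> p (J_star w) = (norm p)\<^sup>2 - 2 * \<langle>p, w\<rangle> + (norm w)\<^sup>2"
  using norm_J[OF us, of "J_star w"] by (simp add: lyapunov_def J_J_star[OF us uc])

text \<open>\<open>lyapunov_J_star\<close> evaluates \<open>\<phi> (J_star w) (J_star (s n))\<close>
  without applying \<open>J_star\<close> to \<open>s n\<close>, so it tends to 0; uniform convexity
  turns this into norm convergence.\<close>

lemma tendsto_J_star: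
  fixes w :: "'a::banach dual"
  assumes us: "uniformly_smooth_space TYPE('a)" and uc: "uniformly_convex_space TYPE('a)"
    and lim: "s \<longlonglongrightarrow> w"
  shows "(\<lambda>n. J_star (s n)) \<longlonglongrightarrow> J_star w"
proof -
  have "(\<lambda>n. \<phi> (J_star w) (J_star (s n))) \<longlonglongrightarrow> \<phi> (J_star w) (J_star w)"
    unfolding lyapunov_J_star[OF us uc]
    by (intro tendsto_intros blinfun.tendsto lim)
  then have "(\<lambda>n. J_star w - J_star (s n)) \<longlonglongrightarrow> 0"
    by (intro lyapunov_tendsto_0_imp_diff_tendsto_0[OF us uc]) (simp_all add: lyapunov_self[OF us])
  from tendsto_diff[OF tendsto_const[of "J_star w"] this] show ?thesis
    by simp
qed

text \<open>By \<open>lyapunov_J_star\<close> the functional is affine plus the squared norm in the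
  dual variable, hence convex.\<close>

lemma lyapunov_convex_comb3:
  fixes p :: "'a::banach"
  assumes us: "uniformly_smooth_space TYPE('a)" and uc: "uniformly_convex_space TYPE('a)"
    and nonneg: "0 \<le> a" "0 \<le> b" "0 \<le> c" and sum: "a + b + c = 1"
  shows "\<phi> p (J_star (a *\<^sub>R u + b *\<^sub>R v + c *\<^sub>R w))
    \<le> a * \<phi> p (J_star u) + b * \<phi> p (J_star v) + c * \<phi> p (J_star w)"
proof -
  define m where "m = a * norm u + b * norm v + c * norm w"
  have "norm (a *\<^sub>R u + b *\<^sub>R v + c *\<^sub>R w) \<le> norm (a *\<^sub>R u) + norm (b *\<^sub>R v) + norm (c *\<^sub>R w)"
    by (meson add_right_mono norm_triangle_ineq order_trans)
  also have "\<dots> = m"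
    using nonneg by (simp add: m_def)
  finally have "(norm (a *\<^sub>R u + b *\<^sub>R v + c *\<^sub>R w))\<^sup>2 \<le> m\<^sup>2"
    by (simp add: power_mono)
  also have "m\<^sup>2 \<le> a * (norm u)\<^sup>2 + b * (norm v)\<^sup>2 + c * (norm w)\<^sup>2"
  proof -
    \<comment> \<open>\<open>m\<close> is the weighted mean of the norms, and this is their weighted
      variance.\<close>
    have "0 \<le> a * (norm u - m)\<^sup>2 + b * (norm v - m)\<^sup>2 + c * (norm w - m)\<^sup>2"
      using nonneg by simp
    also have "\<dots> = a * (norm u)\<^sup>2 + b * (norm v)\<^sup>2 + c * (norm w)\<^sup>2
        - 2 * m * (a * norm u + b * norm v + c * norm w) + (a + b + c) * m\<^sup>2"
      by (simp add: power2_diff algebra_simps)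
    also have "\<dots> = a * (norm u)\<^sup>2 + b * (norm v)\<^sup>2 + c * (norm w)\<^sup>2 - m\<^sup>2"
      unfolding sum m_def[symmetric] by (simp add: power2_eq_square)
    finally show ?thesis by simp
  qed
  finally have sq: "(norm (a *\<^sub>R u + b *\<^sub>R v + c *\<^sub>R w))\<^sup>2 \<le> a * (norm u)\<^sup>2 + b * (norm v)\<^sup>2 + c * (norm w)\<^sup>2" .
  have "(norm p)\<^sup>2 = a * (norm p)\<^sup>2 + b * (norm p)\<^sup>2 + c * (norm p)\<^sup>2"
    using sum by (simp flip: distrib_right)
  with sq show ?thesis
    unfolding lyapunov_J_star[OF us uc]
    by (simp add: blinfun.add_left blinfun.scaleR_left algebra_simps)
qed

section \<open>Retractions and equilibrium problems\<close>

text \<open>Sunniness sends the points \<open>s n\<close> of the ray from \<open>R x\<close> through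
  \<open>x\<close> back to \<open>R x\<close>. Comparing \<open>\<phi> (R x) y\<close> with
  \<open>\<phi> (s n) y\<close> gives the inequality at \<open>s n\<close>, which tends to
  \<open>R x\<close>.\<close>

lemma sunny_gen_nonexp_retraction_variational:
  fixes x :: "'a::real_normed_vector"
  assumes us: "uniformly_smooth_space TYPE('a)"
    and R: "sunny_gen_nonexp_retraction D R" and y: "y \<in> D"
  shows "0 \<le> \<langle>x - R x, J (R x) - J y\<rangle>"
proof -
  define s where "s n = R x + (1 / real (Suc n)) *\<^sub>R (x - R x)" for n
  have nonneg: "0 \<le> \<langle>x - R x, J (s n) - J y\<rangle>" for n
  proof -
    have "R (s n) = R x"
      using R by (simp add: s_def sunny_gen_nonexp_retraction_def sunny_def)
    then have "\<phi> (R x) y \<le> \<phi> (s n) y"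
      using R y by (metis sunny_gen_nonexp_retraction_def gen_nonexpansive_onto_def)
    then have "\<langle>R x - s n, J (s n) - J y\<rangle> \<le> 0"
      using lyapunov_three_point[OF us, of "R x" y "s n"] lyapunov_nonneg[OF us, of "R x" "s n"] by simp
    moreover have "R x - s n = - (1 / real (Suc n)) *\<^sub>R (x - R x)"
      by (simp add: s_def)
    ultimately have "0 \<le> (1 / real (Suc n)) * \<langle>x - R x, J (s n) - J y\<rangle>"
      by (simp only: blinfun.scaleR_right) simp
    then show ?thesis
      by (simp add: zero_le_divide_iff)
  qed
  have "s \<longlonglongrightarrow> R x + 0 *\<^sub>R (x - R x)"
    unfolding s_def by (intro tendsto_intros lim_1_over_n[THEN LIMSEQ_Suc])
  then have "(\<lambda>n. \<langle>x - R x, J (s n) - J y\<rangle>) \<longlonglongrightarrow> \<langle>x - R x, J (R x) - J y\<rangle>"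
    by (intro blinfun.tendsto tendsto_intros tendsto_J[OF us]) simp
  then show ?thesis
    using nonneg by (intro LIMSEQ_le_const) auto
qed

lemma sunny_gen_nonexp_retraction_lyapunov:
  fixes x :: "'a::real_normed_vector"
  assumes us: "uniformly_smooth_space TYPE('a)"
    and R: "sunny_gen_nonexp_retraction D R" and y: "y \<in> D"
  shows "\<phi> x (R x) + \<phi> (R x) y \<le> \<phi> x y"
  using sunny_gen_nonexp_retraction_variational[OF assms, of x] lyapunov_three_point[OF us, of x y "R x"]
  by simp

text \<open>The hypothesis \<open>le\<close> is what (A2) makes of a resolvent inequality: the
  arguments of \<open>g\<close> are swapped, and \<open>c\<close> bounds the vanishing resolvent
  term.\<close>

lemma equilibrium_limit:
  fixes g :: "'b::real_normed_vector \<Rightarrow> 'b \<Rightarrow> real"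
  assumes D: "convex D" and A1: "bifunction_A1 D g" and A3: "bifunction_A3 D g"
    and A4: "bifunction_A4 D g"
    and s: "\<And>n. s n \<in> D" "s \<longlonglongrightarrow> w" and w: "w \<in> D"
    and le: "\<And>y n. y \<in> D \<Longrightarrow> g y (s n) \<le> c y n" and c: "\<And>y. y \<in> D \<Longrightarrow> c y \<longlonglongrightarrow> 0"
    and y: "y \<in> D"
  shows "0 \<le> g w y"
proof -
  \<comment> \<open>Minty's argument: \<open>w\<close> solves the dual problem by lower semicontinuity, hence the primal one by
    testing along the segment from \<open>w\<close> to \<open>y\<close>.\<close>
  have le0: "g v w \<le> 0" if v: "v \<in> D" for v
  proof (rule ccontr)
    assume "\<not> g v w \<le> 0"
    \<comment> \<open>Lower semicontinuity gives only bounds strictly below \<open>g v w\<close>;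
      half the value still contradicts the limit 0 of \<open>c v\<close>.\<close>
    define b where "b = g v w / 2"
    have b: "0 < b" "b < g v w"
      using \<open>\<not> g v w \<le> 0\<close> by (auto simp: b_def)
    have "\<forall>\<^sub>F u in at w within D. b < g v u"
      using A4 v w b unfolding bifunction_A4_def lsc_on_def by blast
    then have "\<forall>\<^sub>F u in nhds w. u \<in> D \<longrightarrow> b < g v u"
      unfolding eventually_at_filter by eventually_elim (use b in auto)
    then have "\<forall>\<^sub>F n in sequentially. s n \<in> D \<longrightarrow> b < g v (s n)"
      using s(2) by (rule eventually_compose_filterlim)
    then have "\<forall>\<^sub>F n in sequentially. b \<le> c v n"
      by eventually_elim (use s(1) le[OF v] in \<open>meson less_imp_le order_trans\<close>)
    then have "b \<le> 0"
      by (rule tendsto_lowerbound[OF c[OF v]]) simp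
    with b show False by simp
  qed
  have "0 \<le> g (t *\<^sub>R y + (1 - t) *\<^sub>R w) y" if t: "0 < t" "t < 1" for t :: real
  proof -
    define v where "v = t *\<^sub>R y + (1 - t) *\<^sub>R w"
    have v: "v \<in> D"
      using D y w t unfolding v_def by (intro convexD) auto
    have "convex_on D (g v)"
      using A4 v by (simp add: bifunction_A4_def)
    then have "g v v \<le> t * g v y + (1 - t) * g v w"
      using convex_onD[of D "g v" "1 - t" y w] y w t by (simp add: v_def)
    moreover have "g v v = 0"
      using A1 v by (simp add: bifunction_A1_def)
    moreover have "(1 - t) * g v w \<le> 0"
      using le0[OF v] t by (simp add: mult_nonneg_nonpos)
    ultimately have "0 \<le> t * g v y" by linarith
    then show ?thesis
      using t by (simp add: zero_le_mult_iff v_def)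
  qed
  \<comment> \<open>(A3) bounds the limit superior from above by \<open>g w y\<close>, so
    nonnegativity for small \<open>t\<close> passes to \<open>g w y\<close>.\<close>
  then have "\<forall>\<^sub>F t in at_right 0. ereal 0 \<le> ereal (g (t *\<^sub>R y + (1 - t) *\<^sub>R w) y)"
    unfolding eventually_at_right_field by (intro exI[of _ 1]) auto
  then have "ereal 0 \<le> Limsup (at_right 0) (\<lambda>t::real. ereal (g (t *\<^sub>R y + (1 - t) *\<^sub>R w) y))"
    by (intro le_Limsup) simp_all
  also have "\<dots> \<le> ereal (g w y)"
    using A3 y w by (simp add: bifunction_A3_def)
  finally show ?thesis by simp
qed

section \<open>Convergence of the iteration\<close>

lemma cyc_in_range:
  assumes "1 \<le> L"
  shows "cyc n L \<in> {1..L}"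
  using assms mod_less_divisor[of L n] by (auto simp: cyc_def)

text \<open>Along \<open>l + k * L\<close> the iteration uses a single bifunction or operator. In
  the case \<open>l = L\<close>, \<open>cyc\<close> replaces the residue 0.\<close>

lemma cyc_add_mult:
  assumes "l \<in> {1..L}"
  shows "cyc (l + k * L) L = l"
  using assms by (cases "l = L") (auto simp: cyc_def)

theorem theorem3p1:
  fixes C B :: "'a::banach set"
    and f :: "nat \<Rightarrow> 'a dual \<Rightarrow> 'a dual \<Rightarrow> real"
    and T A :: "nat \<Rightarrow> 'a \<Rightarrow> 'a dual"
    and \<Gamma> :: "('a \<Rightarrow> 'a dual) set"
    and L N :: nat
    and \<alpha>1 \<alpha>2 \<alpha>3 a :: real
    and r :: "nat \<Rightarrow> real"
    and x :: 'a
    and X Y Z U :: "nat \<Rightarrow> 'a"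
    and CC :: "nat \<Rightarrow> 'a set"
    and R :: "nat \<Rightarrow> 'a \<Rightarrow> 'a"
  assumes "uniformly_smooth_space TYPE('a)"
    and "uniformly_convex_space TYPE('a)"
    and "C \<noteq> {}" and "closed C" and "convex C"
    and "closed (J ` C)" and "convex (J ` C)"
    and "L \<ge> 1" and "N \<ge> 1"
    and "\<forall>l\<in>{1..L}. bifunction_A1 (J ` C) (f l) \<and> bifunction_A2 (J ` C) (f l)
           \<and> bifunction_A3 (J ` C) (f l) \<and> bifunction_A4 (J ` C) (f l)"
    and "\<forall>n\<ge>1. gen_J_star_nonexpansive C (T n)"
    and "\<forall>k\<in>{1..N}. continuous_on C (A k) \<and> monotone_operator_on C (A k)"
    and "\<forall>S\<in>\<Gamma>. J_star_closed C S \<and> gen_J_star_nonexpansive C S"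
    and "(\<Inter>n\<in>{1..}. J_fixed C (T n)) = J_fixed_family C \<Gamma>"
    and "J_fixed_family C \<Gamma> \<noteq> {}"
    and "B = J_fixed_family C \<Gamma> \<inter> (\<Inter>l\<in>{1..L}. EP C (f l)) \<inter> (\<Inter>k\<in>{1..N}. VI C (A k))"
    and "B \<noteq> {}"
    and "convex (J ` J_fixed_family C \<Gamma>)"
    and "NST_condition C T \<Gamma>"
    and "\<alpha>1 \<in> {0<..<1}" and "\<alpha>2 \<in> {0<..<1}" and "\<alpha>3 \<in> {0<..<1}"
    and "\<alpha>1 + \<alpha>2 + \<alpha>3 = 1"
    and "a > 0" and "\<forall>n\<ge>1. r n \<ge> a"
    and "x \<in> C" and "X 1 = x" and "CC 1 = C"
    and "\<forall>n\<ge>1. Z n \<in> C \<and>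
           (\<forall>y\<in>C. f (cyc n L) (J (Z n)) (J y)
                    + (1 / r n) * \<langle>y - Z n, J (Z n) - J (X n)\<rangle> \<ge> 0)"
    and "\<forall>n\<ge>1. U n \<in> C \<and>
           (\<forall>y\<in>C. \<langle>y - U n, A (cyc n N) (U n)\<rangle>
                    + (1 / r n) * \<langle>y - U n, J (U n) - J (X n)\<rangle> \<ge> 0)"
    and "\<forall>n\<ge>1. Y n = J_star (\<alpha>1 *\<^sub>R J (X n) + \<alpha>2 *\<^sub>R J (Z n) + \<alpha>3 *\<^sub>R T n (U n))"
    and "\<forall>n\<ge>1. CC (n + 1) = {z \<in> CC n. \<phi> z (Y n) \<le> \<phi> z (X n)}"
    and "\<forall>n\<ge>1. sunny_gen_nonexp_retraction (CC (n + 1)) (R (n + 1))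
           \<and> X (n + 1) = R (n + 1) x"
  shows "(\<exists>q\<in>B. X \<longlonglongrightarrow> q) \<and>
         (\<forall>R\<^sub>B. sunny_gen_nonexp_retraction B R\<^sub>B \<longrightarrow> X \<longlonglongrightarrow> R\<^sub>B x)"
proof -
  note us = assms(1) and uc = assms(2)
  note Z = assms(29)[rule_format] and U = assms(30)[rule_format] and Y = assms(31)[rule_format]
  note CC = assms(32)[rule_format] and R = assms(33)[rule_format]
  have \<alpha>: "0 < \<alpha>1" "0 < \<alpha>2" "0 < \<alpha>3"
    using assms(20-22) by simp_all
  have r_pos: "0 < r n" "1 / r n \<le> 1 / a" if "1 \<le> n" for n
    using assms(24,25) that by (force, simp add: frac_le)
  note A1_A4 = assms(10)[rule_format]
  have f_mono: "f l v w + f l w v \<le> 0" if "l \<in> {1..L}" "v \<in> J ` C" "w \<in> J ` C" for l v w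
    using A1_A4[OF that(1)] that(2,3) unfolding bifunction_A2_def by blast

  \<comment> \<open>Nestedness of the sets \<open>CC n\<close>\<close>
  have CC_antimono: "CC n \<subseteq> CC m" if "m \<le> n" "1 \<le> m" for m n
    using that by (induction n rule: dec_induct) (use CC in auto)
  then have CC_sub: "CC n \<subseteq> C" if "1 \<le> n" for n
    using that assms(28) by (metis le_refl)
  have X_in_CC: "X n \<in> CC n" if n: "1 \<le> n" for n
  proof (cases "n = 1")
    case False
    then obtain m where "n = m + 1" "1 \<le> m"
      using n by (cases n) auto
    then show ?thesis
      using R[of m] by (auto simp: sunny_gen_nonexp_retraction_def retraction_onto_def)
  qed (use assms(26-28) in simp)

  \<comment> \<open>Descent inequality for points of \<open>B\<close>\<close>
  have descent: "\<phi> p (Y n) + \<alpha>2 * \<phi> (Z n) (X n) + \<alpha>3 * \<phi> (U n) (X n) \<le> \<phi> p (X n)"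
    if p: "p \<in> B" and n: "1 \<le> n" for p n
  proof -
    have pC: "p \<in> C" and pT: "p \<in> J_fixed C (T n)" and pEP: "p \<in> EP C (f (cyc n L))"
      and pVI: "p \<in> VI C (A (cyc n N))"
      using p n cyc_in_range[OF assms(8), of n] cyc_in_range[OF assms(9), of n]
      unfolding assms(16) assms(14)[symmetric] by (auto simp: EP_def)
    \<comment> \<open>As \<open>p\<close> solves the equilibrium problem, (A2) gives the sign of the
      swapped value; the resolvent inequality tested at \<open>p\<close> then leaves a nonnegative
      pairing.\<close>
    have "f (cyc n L) (J (Z n)) (J p) \<le> 0"
      using f_mono[OF cyc_in_range[OF assms(8)], of "J (Z n)" "J p" n] pEP pC Z[OF n]
      by (auto simp: EP_def)
    then have "0 \<le> (1 / r n) * \<langle>p - Z n, J (Z n) - J (X n)\<rangle>"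
      using Z[OF n] pC by (smt (verit))
    then have Zn: "\<phi> p (Z n) + \<phi> (Z n) (X n) \<le> \<phi> p (X n)"
      using r_pos(1)[OF n] lyapunov_three_point[OF us, of p "X n" "Z n"]
      by (simp add: zero_le_divide_iff)
    \<comment> \<open>Monotonicity takes over the part of (A2): it carries the variational
      inequality at \<open>p\<close> to the operator value at \<open>U n\<close>.\<close>
    have "\<langle>p - U n, A (cyc n N) (U n)\<rangle> \<le> 0"
    proof -
      have "0 \<le> \<langle>p - U n, A (cyc n N) p - A (cyc n N) (U n)\<rangle>"
        using assms(12) cyc_in_range[OF assms(9), of n] pC U[OF n]
        by (auto simp: monotone_operator_on_def)
      moreover have "0 \<le> \<langle>U n - p, A (cyc n N) p\<rangle>"
        using pVI U[OF n] by (auto simp: VI_def)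
      ultimately show ?thesis
        by (simp add: blinfun.diff_left blinfun.diff_right)
    qed
    then have "0 \<le> (1 / r n) * \<langle>p - U n, J (U n) - J (X n)\<rangle>"
      using U[OF n] pC by (smt (verit))
    then have Un: "\<phi> p (U n) + \<phi> (U n) (X n) \<le> \<phi> p (X n)"
      using r_pos(1)[OF n] lyapunov_three_point[OF us, of p "X n" "U n"]
      by (simp add: zero_le_divide_iff)
    have Tn: "\<phi> p (J_star (T n (U n))) \<le> \<phi> p (U n)"
      using assms(11) n pT U[OF n] by (auto simp: gen_J_star_nonexpansive_def)
    have "\<phi> p (Y n) \<le> \<alpha>1 * \<phi> p (X n) + \<alpha>2 * \<phi> p (Z n) + \<alpha>3 * \<phi> p (J_star (T n (U n)))"
      using lyapunov_convex_comb3[OF us uc, of \<alpha>1 \<alpha>2 \<alpha>3 p "J (X n)" "J (Z n)" "T n (U n)"]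
        \<alpha> assms(23) Y[OF n] by (simp add: J_star_J[OF us uc])
    also have "\<dots> \<le> \<alpha>1 * \<phi> p (X n) + \<alpha>2 * (\<phi> p (X n) - \<phi> (Z n) (X n))
        + \<alpha>3 * (\<phi> p (X n) - \<phi> (U n) (X n))"
      using \<alpha> Zn Un Tn by (intro add_mono mult_left_mono) auto
    also have "\<dots> = (\<alpha>1 + \<alpha>2 + \<alpha>3) * \<phi> p (X n) - \<alpha>2 * \<phi> (Z n) (X n) - \<alpha>3 * \<phi> (U n) (X n)"
      by (simp add: algebra_simps)
    finally show ?thesis
      using assms(23) by simp
  qed

  \<comment> \<open>Inclusion of \<open>B\<close> in every \<open>CC n\<close>\<close>
  have B_sub_CC: "p \<in> CC n" if p: "p \<in> B" and "1 \<le> n" for p n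
    using that(2)
  proof (induction n rule: nat_induct_at_least)
    case base
    have "B \<subseteq> C"
      using assms(8) unfolding assms(16) by (force simp: EP_def)
    then show ?case
      using p assms(28) by auto
  next
    case (Suc n)
    have "0 \<le> \<alpha>2 * \<phi> (Z n) (X n)" "0 \<le> \<alpha>3 * \<phi> (U n) (X n)"
      using \<alpha> lyapunov_nonneg[OF us] by simp_all
    then show ?case
      using Suc descent[OF p Suc.hyps] CC[OF Suc.hyps] by simp
  qed

  \<comment> \<open>Lyapunov distances from \<open>x\<close> to the iterates\<close>
  have X_proj: "\<phi> x (X n) + \<phi> (X n) y \<le> \<phi> x y" if n: "1 \<le> n" and y: "y \<in> CC n" for n y
  proof (cases "n = 1")
    case True
    then show ?thesis
      using assms(27) lyapunov_self[OF us] by simp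
  next
    case False
    then obtain m where m: "n = m + 1" "1 \<le> m"
      using n by (cases n) auto
    then show ?thesis
      using sunny_gen_nonexp_retraction_lyapunov[OF us conjunct1[OF R[OF m(2)]], of y x] R[OF m(2)] y
      by simp
  qed

  obtain p where p: "p \<in> B"
    using assms(17) by blast
  have X_le: "\<phi> x (X n) \<le> \<phi> x b" if "b \<in> B" "1 \<le> n" for b n
    using X_proj[OF that(2) B_sub_CC[OF that]] lyapunov_nonneg[OF us, of "X n" b] by simp
  \<comment> \<open>Later iterates lie in the earlier set \<open>CC m\<close>, so
    \<open>X_proj\<close> bounds their Lyapunov distance by increments of one monotone
    sequence.\<close>
  have X_step: "\<phi> (X m) (X n) \<le> \<phi> x (X n) - \<phi> x (X m)" if "m \<le> n" "1 \<le> m" for m n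
    using X_proj[of m "X n"] X_in_CC[of n] CC_antimono[OF that] that by force

  \<comment> \<open>Strong convergence of the iterates\<close>
  have lyapunov_Cauchy: "Cauchy (\<lambda>n. \<phi> x (X (Suc n)))"
  proof -
    have "incseq (\<lambda>n. \<phi> x (X (Suc n)))"
    proof (rule incseq_SucI)
      fix n
      show "\<phi> x (X (Suc n)) \<le> \<phi> x (X (Suc (Suc n)))"
        using X_step[of "Suc n" "Suc (Suc n)"] lyapunov_nonneg[OF us, of "X (Suc n)" "X (Suc (Suc n))"]
        by simp
    qed
    moreover have "\<phi> x (X (Suc n)) \<le> \<phi> x p" for n
      using X_le[OF p] by simp
    ultimately show ?thesis
      by (metis incseq_convergent LIMSEQ_imp_Cauchy)
  qed
  have X_bound: "norm (X (Suc n)) \<le> norm x + sqrt (\<phi> x p)" for n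
  proof -
    have "(norm x - norm (X (Suc n)))\<^sup>2 \<le> \<phi> x p"
      using lyapunov_ge[OF us, of x "X (Suc n)"] X_le[OF p, of "Suc n"] by simp
    then have "\<bar>norm x - norm (X (Suc n))\<bar> \<le> sqrt (\<phi> x p)"
      by (rule real_le_rsqrt[of "\<bar>_\<bar>", simplified])
    then show ?thesis by linarith
  qed
  have "Cauchy (\<lambda>n. X (Suc n))"
  proof (rule metric_CauchyI)
    fix e :: real assume "0 < e"
    have "0 \<le> norm x + sqrt (\<phi> x p)"
      using lyapunov_nonneg[OF us] by simp
    from lyapunov_small_imp_close[OF us uc \<open>0 < e\<close> this] obtain d where "0 < d" and
      d: "\<And>u v :: 'a. norm u \<le> norm x + sqrt (\<phi> x p) \<or> norm v \<le> norm x + sqrt (\<phi> x p)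
        \<Longrightarrow> \<phi> u v < d \<Longrightarrow> norm (u - v) < e"
      by blast
    obtain k where k: "\<And>m n. k \<le> m \<Longrightarrow> k \<le> n \<Longrightarrow> dist (\<phi> x (X (Suc m))) (\<phi> x (X (Suc n))) < d"
      using metric_CauchyD[OF lyapunov_Cauchy \<open>0 < d\<close>] by blast
    have le: "dist (X (Suc m)) (X (Suc n)) < e" if "k \<le> m" "m \<le> n" for m n
      using d[of "X (Suc m)" "X (Suc n)"] X_bound[of m] X_step[of "Suc m" "Suc n"] k[of m n] that
      by (simp add: dist_norm)
    have "dist (X (Suc m)) (X (Suc n)) < e" if "k \<le> m" "k \<le> n" for m n
      using le[of m n] le[of n m] that by (metis dist_commute linorder_le_cases)
    then show "\<exists>k. \<forall>m\<ge>k. \<forall>n\<ge>k. dist (X (Suc m)) (X (Suc n)) < e"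
      by blast
  qed
  then obtain q where X1: "(\<lambda>n. X (Suc n)) \<longlonglongrightarrow> q"
    using Cauchy_convergent convergent_def by blast
  then have Xq: "X \<longlonglongrightarrow> q"
    by (rule LIMSEQ_imp_Suc)
  have qC: "q \<in> C"
    by (rule closed_sequentially[OF assms(4) _ X1]) (use X_in_CC CC_sub in force)

  \<comment> \<open>Convergence of \<open>Y\<close>, \<open>Z\<close> and \<open>U\<close> to the
    same limit\<close>
  have Y1: "(\<lambda>n. Y (Suc n)) \<longlonglongrightarrow> q"
  proof -
    have X2: "(\<lambda>n. X (Suc (Suc n))) \<longlonglongrightarrow> q"
      by (rule LIMSEQ_Suc[OF X1])
    have "(\<lambda>n. \<phi> (X (Suc (Suc n))) (X (Suc n))) \<longlonglongrightarrow> 0"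
      using tendsto_lyapunov[OF us X2 X1] lyapunov_self[OF us] by simp
    then have "(\<lambda>n. \<phi> (X (Suc (Suc n))) (Y (Suc n))) \<longlonglongrightarrow> 0"
    proof (rule tendsto_sandwich[rotated 3])
      \<comment> \<open>\<open>X (Suc (Suc n))\<close> lies in \<open>CC (Suc (Suc n))\<close>,
        whose defining inequality compares \<open>Y (Suc n)\<close> with
        \<open>X (Suc n)\<close>.\<close>
      show "\<forall>\<^sub>F n in sequentially. \<phi> (X (Suc (Suc n))) (Y (Suc n)) \<le> \<phi> (X (Suc (Suc n))) (X (Suc n))"
        using X_in_CC[of "Suc (Suc _)"] CC[of "Suc _"] by (intro always_eventually) auto
    qed (auto simp: lyapunov_nonneg[OF us])
    then have "(\<lambda>n. X (Suc (Suc n)) - Y (Suc n)) \<longlonglongrightarrow> 0"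
      by (rule lyapunov_tendsto_0_imp_diff_tendsto_0[OF us uc])
        (use convergent_imp_bounded[OF X2] in blast)
    from tendsto_diff[OF X2 this] show ?thesis by simp
  qed

  have gap: "(\<lambda>n. \<phi> p (X (Suc n)) - \<phi> p (Y (Suc n))) \<longlonglongrightarrow> 0"
    using tendsto_diff[OF tendsto_lyapunov[OF us tendsto_const[of p] X1]
        tendsto_lyapunov[OF us tendsto_const[of p] Y1]]
    by simp
  \<comment> \<open>A generic \<open>V\<close> lets \<open>Z\<close> with weight
    \<open>\<alpha>2\<close> and \<open>U\<close> with weight \<open>\<alpha>3\<close> share one
    argument; \<open>le\<close> is extracted from \<open>descent\<close>.\<close>
  have resolvent_lim: "(\<lambda>n. V (Suc n)) \<longlonglongrightarrow> q"
    if "0 < c" and le: "\<And>n. 1 \<le> n \<Longrightarrow> c * \<phi> (V n) (X n) \<le> \<phi> p (X n) - \<phi> p (Y n)" for c V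
  proof -
    have "(\<lambda>n. (\<phi> p (X (Suc n)) - \<phi> p (Y (Suc n))) / c) \<longlonglongrightarrow> 0 / c"
      using \<open>0 < c\<close> by (intro tendsto_divide gap) auto
    then have "(\<lambda>n. (\<phi> p (X (Suc n)) - \<phi> p (Y (Suc n))) / c) \<longlonglongrightarrow> 0"
      by simp
    then have "(\<lambda>n. \<phi> (V (Suc n)) (X (Suc n))) \<longlonglongrightarrow> 0"
    proof (rule tendsto_sandwich[rotated 3])
      show "\<forall>\<^sub>F n in sequentially. \<phi> (V (Suc n)) (X (Suc n)) \<le> (\<phi> p (X (Suc n)) - \<phi> p (Y (Suc n))) / c"
        using le[of "Suc _"] \<open>0 < c\<close> by (intro always_eventually) (simp add: field_simps)
    qed (auto simp: lyapunov_nonneg[OF us])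
    then have "(\<lambda>n. V (Suc n) - X (Suc n)) \<longlonglongrightarrow> 0"
      by (rule lyapunov_tendsto_0_imp_diff_tendsto_0[OF us uc])
        (use convergent_imp_bounded[OF X1] in blast)
    from tendsto_add[OF this X1] show ?thesis by simp
  qed
  have "0 \<le> \<alpha>2 * \<phi> (Z n) (X n)" "0 \<le> \<alpha>3 * \<phi> (U n) (X n)" for n
    using \<alpha> lyapunov_nonneg[OF us] by simp_all
  then have "\<alpha>2 * \<phi> (Z n) (X n) \<le> \<phi> p (X n) - \<phi> p (Y n)"
    "\<alpha>3 * \<phi> (U n) (X n) \<le> \<phi> p (X n) - \<phi> p (Y n)" if "1 \<le> n" for n
    using descent[OF p that] by (smt (verit))+
  then have Z1: "(\<lambda>n. Z (Suc n)) \<longlonglongrightarrow> q" and U1: "(\<lambda>n. U (Suc n)) \<longlonglongrightarrow> q"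
    using resolvent_lim \<alpha> by blast+

  \<comment> \<open>The limit as a common \<open>J\<close>-fixed point\<close>
  have T1: "(\<lambda>n. T (Suc n) (U (Suc n))) \<longlonglongrightarrow> J q"
  proof -
    \<comment> \<open>The definition of \<open>Y\<close> is solved for the term with weight
      \<open>\<alpha>3\<close>; everything on the right converges.\<close>
    have "T (Suc n) (U (Suc n)) =
        (1 / \<alpha>3) *\<^sub>R (J (Y (Suc n)) - \<alpha>1 *\<^sub>R J (X (Suc n)) - \<alpha>2 *\<^sub>R J (Z (Suc n)))" for n
      using Y[of "Suc n"] \<alpha> by (simp add: J_J_star[OF us uc])
    moreover have "(\<lambda>n. (1 / \<alpha>3) *\<^sub>R (J (Y (Suc n)) - \<alpha>1 *\<^sub>R J (X (Suc n)) - \<alpha>2 *\<^sub>R J (Z (Suc n))))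
        \<longlonglongrightarrow> (1 / \<alpha>3) *\<^sub>R (J q - \<alpha>1 *\<^sub>R J q - \<alpha>2 *\<^sub>R J q)"
      by (intro tendsto_intros tendsto_J[OF us] X1 Y1 Z1)
    moreover have "J q - \<alpha>1 *\<^sub>R J q - \<alpha>2 *\<^sub>R J q = \<alpha>3 *\<^sub>R J q"
    proof -
      have "\<alpha>3 = 1 - \<alpha>1 - \<alpha>2"
        using assms(23) by simp
      then show ?thesis
        by (simp add: scaleR_left_diff_distrib)
    qed
    ultimately show ?thesis
      using \<alpha> by simp
  qed

  have "q \<in> J_fixed C S" if S: "S \<in> \<Gamma>" for S
  proof -
    have "(\<lambda>n. norm (J (U (Suc n)) - T (Suc n) (U (Suc n)))) \<longlonglongrightarrow> norm (J q - J q)"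
      by (intro tendsto_intros tendsto_J[OF us] U1 T1)
    then have "(\<lambda>n. norm (J (U n) - T n (U n))) \<longlonglongrightarrow> 0"
      by (intro LIMSEQ_imp_Suc[of "\<lambda>n. norm (J (U n) - T n (U n))"]) simp
    moreover have "bounded (U ` {1..})"
      using convergent_imp_bounded[OF LIMSEQ_imp_Suc[OF U1]] by (rule bounded_subset) auto
    ultimately have "(\<lambda>n. norm (J (U n) - S (U n))) \<longlonglongrightarrow> 0"
      using assms(19) U S unfolding NST_condition_def by blast
    from LIMSEQ_Suc[OF this] have "(\<lambda>n. J (U (Suc n)) - S (U (Suc n))) \<longlonglongrightarrow> 0"
      by (rule tendsto_norm_zero_cancel)
    from tendsto_diff[OF tendsto_J[OF us U1] this] have "(\<lambda>n. S (U (Suc n))) \<longlonglongrightarrow> J q"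
      by simp
    from tendsto_J_star[OF us uc this] have "(\<lambda>n. (J_star \<circ> S) (U (Suc n))) \<longlonglongrightarrow> q"
      by (simp add: J_star_J[OF us uc])
    \<comment> \<open>\<open>J_star_closed\<close> wants every term in \<open>C\<close>, index 0
      included, while \<open>U 0\<close> is unconstrained; hence the shift.\<close>
    moreover have "U (Suc n) \<in> C" for n
      using U by simp
    moreover have "J_star_closed C S"
      using assms(13) S by blast
    ultimately have "(J_star \<circ> S) q = q"
      using U1 unfolding J_star_closed_def by (elim allE[of _ "\<lambda>n. U (Suc n)"]) blast
    then have "S q = J q"
      using J_J_star[OF us uc, of "S q"] by simp
    then show ?thesis
      using qC by (simp add: J_fixed_def)
  qed
  then have q_fixed: "q \<in> J_fixed_family C \<Gamma>"
    by (simp add: J_fixed_family_def)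

  \<comment> \<open>Resolvent terms along residue classes\<close>
  have subseq_lim: "(\<lambda>k. V (l + k * K)) \<longlonglongrightarrow> v"
    if "(\<lambda>n. V (Suc n)) \<longlonglongrightarrow> v" "1 \<le> K" for V :: "nat \<Rightarrow> 'a" and v l K
  proof -
    have "strict_mono (\<lambda>k. l + k * K)"
      using that(2) by (intro strict_monoI) simp
    from LIMSEQ_subseq_LIMSEQ[OF LIMSEQ_imp_Suc[OF that(1)] this] show ?thesis
      by (simp add: o_def)
  qed
  \<comment> \<open>The lower bound \<open>a\<close> for \<open>r n\<close> replaces the varying
    coefficient by a fixed one; the product vanishes once \<open>V\<close> and \<open>W\<close> run
    to a common limit.\<close>
  have error_le: "(1 / r n) * \<langle>y - V, J V - J W\<rangle> \<le> (1 / a) * (norm (y - V) * norm (J V - J W))"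
    if "1 \<le> n" for n y V W
  proof -
    have "\<langle>y - V, J V - J W\<rangle> \<le> norm (y - V) * norm (J V - J W)"
      using norm_blinfun[of "J V - J W" "y - V"] by (simp add: mult.commute)
    then have "(1 / r n) * \<langle>y - V, J V - J W\<rangle> \<le> (1 / r n) * (norm (y - V) * norm (J V - J W))"
      using r_pos(1)[OF that] by (intro mult_left_mono) simp_all
    also have "\<dots> \<le> (1 / a) * (norm (y - V) * norm (J V - J W))"
      using r_pos(2)[OF that] by (intro mult_right_mono) simp_all
    finally show ?thesis .
  qed
  have error_lim: "(\<lambda>k. (1 / a) * (norm (y - V (l + k * K)) * norm (J (V (l + k * K)) - J (X (l + k * K)))))
      \<longlonglongrightarrow> 0" if "(\<lambda>n. V (Suc n)) \<longlonglongrightarrow> q" "1 \<le> K" for V y l K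
  proof -
    have "(\<lambda>k. (1 / a) * (norm (y - V (l + k * K)) * norm (J (V (l + k * K)) - J (X (l + k * K)))))
      \<longlonglongrightarrow> (1 / a) * (norm (y - q) * norm (J q - J q))"
      by (intro tendsto_intros tendsto_J[OF us] subseq_lim[OF that] subseq_lim[OF X1 that(2)])
    then show ?thesis by simp
  qed

  \<comment> \<open>Equilibrium problems at the limit\<close>
  have q_EP: "q \<in> EP C (f l)" if l: "l \<in> {1..L}" for l
  proof -
    have "0 \<le> f l (J q) (J y)" if y: "y \<in> C" for y
    proof (rule equilibrium_limit[OF assms(7)])
      show "bifunction_A1 (J ` C) (f l)" "bifunction_A3 (J ` C) (f l)" "bifunction_A4 (J ` C) (f l)"
        using A1_A4[OF l] by simp_all
      have n1: "1 \<le> l + k * L" for k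
        using l by simp
      show ZC: "J (Z (l + k * L)) \<in> J ` C" for k
        using Z[OF n1] by blast
      show "(\<lambda>k. J (Z (l + k * L))) \<longlonglongrightarrow> J q"
        by (rule tendsto_J[OF us subseq_lim[OF Z1 assms(8)]])
      show "J q \<in> J ` C" "J y \<in> J ` C"
        using qC y by simp_all
      let ?c = "\<lambda>w k. (1 / a) * (norm (J_star w - Z (l + k * L)) * norm (J (Z (l + k * L)) - J (X (l + k * L))))"
      show "?c w \<longlonglongrightarrow> 0" for w
        by (rule error_lim[OF Z1 assms(8)])
      fix w k assume w: "w \<in> J ` C"
      then obtain v where v: "v \<in> C" "w = J v"
        by blast
      have "0 \<le> f l (J (Z (l + k * L))) w
          + (1 / r (l + k * L)) * \<langle>v - Z (l + k * L), J (Z (l + k * L)) - J (X (l + k * L))\<rangle>"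
        using Z[OF n1[of k]] v cyc_add_mult[OF l, of k] by simp
      then show "f l w (J (Z (l + k * L))) \<le> ?c w k"
        using f_mono[OF l w ZC[of k]] error_le[OF n1[of k], of "Z (l + k * L)" "X (l + k * L)" v] v
        by (simp add: J_star_J[OF us uc])
    qed
    then show ?thesis
      using qC by (simp add: EP_def)
  qed

  \<comment> \<open>Variational inequalities at the limit\<close>
  have q_VI: "q \<in> VI C (A l)" if l: "l \<in> {1..N}" for l
  proof -
    have "0 \<le> \<langle>y - q, A l q\<rangle>" if y: "y \<in> C" for y
    proof -
      have n1: "1 \<le> l + k * N" for k
        using l by simp
      note U_lim = subseq_lim[OF U1 assms(9), of l]
      \<comment> \<open>Continuity of \<open>A l\<close> on \<open>C\<close> lets the limit be taken
        directly in the resolvent inequality.\<close>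
      have "(\<lambda>k. A l (U (l + k * N))) \<longlonglongrightarrow> A l q"
        using assms(12) l U[OF n1] qC
        by (intro continuous_on_tendsto_compose[OF _ U_lim]) auto
      then have "(\<lambda>k. \<langle>y - U (l + k * N), A l (U (l + k * N))\<rangle> + (1 / a) *
          (norm (y - U (l + k * N)) * norm (J (U (l + k * N)) - J (X (l + k * N))))) \<longlonglongrightarrow> \<langle>y - q, A l q\<rangle> + 0"
        by (intro tendsto_add blinfun.tendsto tendsto_diff tendsto_const U_lim error_lim[OF U1 assms(9)])
      moreover have "0 \<le> \<langle>y - U (l + k * N), A l (U (l + k * N))\<rangle> + (1 / a) *
          (norm (y - U (l + k * N)) * norm (J (U (l + k * N)) - J (X (l + k * N))))" for k
      proof -
        have "0 \<le> \<langle>y - U (l + k * N), A l (U (l + k * N))\<rangle>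
            + (1 / r (l + k * N)) * \<langle>y - U (l + k * N), J (U (l + k * N)) - J (X (l + k * N))\<rangle>"
          using U[OF n1[of k]] y cyc_add_mult[OF l, of k] by simp
        then show ?thesis
          using error_le[OF n1[of k], of "U (l + k * N)" "X (l + k * N)" y] by linarith
      qed
      ultimately have "0 \<le> \<langle>y - q, A l q\<rangle> + 0"
        by (intro LIMSEQ_le_const) auto
      then show ?thesis by simp
    qed
    then show ?thesis
      using qC by (simp add: VI_def)
  qed

  \<comment> \<open>Membership in \<open>B\<close> and identification of the limit\<close>
  have qB: "q \<in> B"
    unfolding assms(16) using q_fixed q_EP q_VI by blast

  have "X \<longlonglongrightarrow> R\<^sub>B x" if RB: "sunny_gen_nonexp_retraction B R\<^sub>B" for R\<^sub>B
  proof -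
    have b: "R\<^sub>B x \<in> B"
      using RB by (auto simp: sunny_gen_nonexp_retraction_def retraction_onto_def)
    \<comment> \<open>\<open>R\<^sub>B x\<close> is a competitor in \<open>X_le\<close>, and
      \<open>q\<close> is one in the retraction inequality; together they leave no room for
      \<open>\<phi> (R\<^sub>B x) q\<close>.\<close>
    have "\<phi> x q \<le> \<phi> x (R\<^sub>B x)"
      by (rule LIMSEQ_le_const2[OF tendsto_lyapunov[OF us tendsto_const X1]]) (use X_le[OF b] in auto)
    then have "\<phi> (R\<^sub>B x) q = 0"
      using sunny_gen_nonexp_retraction_lyapunov[OF us RB qB, of x] lyapunov_nonneg[OF us, of "R\<^sub>B x" q]
      by simp
    then show ?thesis
      using lyapunov_eq_0_imp_eq[OF us uc] Xq by metis
  qed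
  with qB Xq show ?thesis by blast
qed

end
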